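(* Let $\mathscr{R}$ be a bipotent, divisible, archimedean, complete semifield. The lattice of finitely generated corner loci in $\mathscr{R}^n$ corresponds to the lattice of principal kernels of $\langle\mathscr{R}\rangle$, and the lattice of regular finitely generated corner loci corresponds to the lattice of regular principal kernels of $\langle\mathscr{R}\rangle$; the correspondence is the one that associates to a principal kernel $K$ of $\langle\mathscr{R}\rangle$ the corner locus which coincides, as a subset of $\mathscr{R}^n$, with its skeleton $Skel(K)$.
   Context: Semifields are commutative, have no zero element and are not fields. Order on $\mathscr{R}$: $a\le b\iff a+b=b$; $\mathscr{R}$ is (isomorphic to) $(\mathbb{R}_{>0},\max,\cdot)$. Elements of $\mathscr{R}(x_1,\dots,x_n)$, the semifield of fractions of $\mathscr{R}[x_1,\dots,x_n]$, are regarded as functions $\mathscr{R}^n\to\mathscr{R}$. A kernel of a semifield $\mathbb S$ is a multiplicative subgroup $K$ with $xa+yb\in K$ whenever $a,b\in K$ and $x+y=1$; principal kernels are those generated by one element. $\langle\mathscr{R}\rangle$ is the kernel of $\mathscr{R}(x_1,\dots,x_n)$ generated by any $\alpha\in\mathscr{R}\setminus\{1\}$; it is a semifield, and its kernels are the kernels of $\mathscr{R}(x_1,\dots,x_n)$ contained in it. Its principal kernels form a lattice under product and intersection. $Skel(K)=\{a\in\mathscr{R}^n: f(a)=1\ \forall f\in K\}$. An element $f=\frac{\sum_i h_i}{\sum_j g_j}$ ($h_i,g_j$ monomials; $h,g$ numerator and denominator) is regular if for every $x\in\mathscr{R}^n$ there are $h_i,g_j$ with $h(x)=h_i(x)$,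 $g(x)=g_j(x)$, $h_i\neq g_j$; a principal kernel is regular if it is generated by a regular element. A supertropical polynomial $f\in\mathcal{F}(\mathscr{R}[x_1,\dots,x_n])$ is a finite formal sum of monomials of $\mathscr{R}[x_1,\dots,x_n]$, each occurring once (tangible monomial) or twice (ghost monomial); $f$ is tangible if no monomial occurs twice. $a\in\mathscr{R}^n$ is a corner root of $f$ if two distinct monomials, or a ghost monomial, attain the maximal value of $f$ at $a$. A finitely generated corner locus is a set $Cor(f_1,\dots,f_r)$ of common corner roots of finitely many supertropical polynomials; it is regular if the $f_i$ can be taken tangible. Finitely generated (regular) corner loci are closed under finite unions and intersections. *)

theory Defs
  imports
    "HOL-Analysis.Finite_Cartesian_Product"
    "HOL-Library.Function_Algebras"
    "HOL-Library.Function_Division"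
    "HOL-Library.Set_Algebras"
    "HOL-Library.Multiset"
begin

section \<open>Semifields\<close>

text \<open>
  Since the nonzero elements of a semifield form a group, an additively neutral element would
  satisfy \<open>z * c = z\<close> for all \<open>c\<close>, so \<open>semifield_no_zero\<close> rules out precisely
  the one-element structure.
\<close>

class semifield = comm_semiring + comm_monoid_mult + inverse +
  assumes semifield_left_inverse: "inverse a * a = 1"
    and semifield_divide: "a / b = a * inverse b"
    and semifield_no_zero: "\<not> (\<forall>a. z + a = a)"

instance "fun" :: (type, semifield) semifield
proof
  fix f g z :: "'a \<Rightarrow> 'b"
  show "inverse f * f = 1"
    by (simp add: fun_eq_iff inverse_fun_def semifield_left_inverse)
  show "f / g = f * inverse g"
    by (simp add: fun_eq_iff inverse_fun_def divide_fun_def semifield_divide)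
  show "\<not> (\<forall>f. z + f = f)"
  proof
    assume z: "\<forall>f. z + f = f"
    have "z undefined + a = a" for a
      using fun_cong[OF z[rule_format, of "\<lambda>_. a"], of undefined] by simp
    then show False
      using semifield_no_zero by blast
  qed
qed

class bipotent_semifield = semifield + ord +
  assumes bipotent: "a + b = a \<or> a + b = b"
    and less_eq_iff_add: "a \<le> b \<longleftrightarrow> a + b = b"
    and less_iff_le_not_le: "a < b \<longleftrightarrow> a \<le> b \<and> \<not> b \<le> a"
begin

subclass linorder
proof
  fix x y z :: 'a
  show "x < y \<longleftrightarrow> x \<le> y \<and> \<not> y \<le> x" by (rule less_iff_le_not_le)
  show "x \<le> x" using bipotent[of x x] by (simp add: less_eq_iff_add)
  show "x \<le> z" if "x \<le> y" "y \<le> z"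
    using that by (metis less_eq_iff_add add.assoc)
  show "x = y" if "x \<le> y" "y \<le> x"
    using that by (metis less_eq_iff_add add.commute)
  show "x \<le> y \<or> y \<le> x"
    using bipotent[of x y] by (auto simp: less_eq_iff_add add.commute)
qed

lemma add_eq_max: "a + b = max a b"
  using bipotent[of a b] by (auto simp: max_def less_eq_iff_add add.commute)

end

class tropical_semifield = bipotent_semifield +
  assumes divisible: "0 < n \<Longrightarrow> \<exists>b. b ^ n = a"
    and archimedean: "(\<forall>k. a ^ k \<le> b \<and> inverse a ^ k \<le> b) \<Longrightarrow> a = 1"
    and complete: "A \<noteq> {} \<Longrightarrow> (\<exists>u. \<forall>a\<in>A. a \<le> u) \<Longrightarrow>
      \<exists>s. (\<forall>a\<in>A. a \<le> s) \<and> (\<forall>u. (\<forall>a\<in>A. a \<le> u) \<longrightarrow> s \<le> u)"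


section \<open>Kernels\<close>

text \<open>
  The semifield is given by its carrier \<open>S\<close>, a subset closed under the operations of the type
  \<open>'a\<close>. The kernel of \<open>S\<close> generated by \<open>A\<close> is \<open>kernel S hull A\<close>.
\<close>

definition kernel :: "'a::semifield set \<Rightarrow> 'a set \<Rightarrow> bool" where
  "kernel S K \<longleftrightarrow> K \<subseteq> S \<and>
     1 \<in> K \<and> (\<forall>a\<in>K. \<forall>b\<in>K. a * b \<in> K) \<and> (\<forall>a\<in>K. inverse a \<in> K) \<and>
     (\<forall>a\<in>K. \<forall>b\<in>K. \<forall>x\<in>S. \<forall>y\<in>S. x + y = 1 \<longrightarrow> x * a + y * b \<in> K)"

definition principal_kernels :: "'a::semifield set \<Rightarrow> 'a set set" where
  "principal_kernels S = {kernel S hull {f} |f. f \<in> S}"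


section \<open>Polynomials and the semifield of fractions\<close>

text \<open>
  The pair \<open>(c, e)\<close> is the monomial with coefficient \<open>c\<close> and exponent \<open>e i\<close> at the
  \<open>i\<close>-th variable. As there is no zero coefficient, a polynomial is a finite nonempty sum of
  monomials, given by its set of terms; by \<open>add_eq_max\<close> its value is a maximum.
  Two terms may have equal exponents: the one with the smaller coefficient is then strictly
  dominated at every point, hence irrelevant to all notions below.
\<close>

type_synonym ('r, 'n) monomial = "'r \<times> ('n \<Rightarrow> nat)"

definition monom_val :: "('r::tropical_semifield, 'n::finite) monomial \<Rightarrow> 'r ^ 'n \<Rightarrow> 'r" where
  "monom_val m x = fst m * (\<Prod>i\<in>UNIV. (x $ i) ^ snd m i)"

definition polynomial :: "('r, 'n) monomial set \<Rightarrow> bool" where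
  "polynomial H \<longleftrightarrow> finite H \<and> H \<noteq> {}"

definition poly_val ::
  "('r::tropical_semifield, 'n::finite) monomial set \<Rightarrow> 'r ^ 'n \<Rightarrow> 'r" where
  "poly_val H x = Max ((\<lambda>m. monom_val m x) ` H)"

definition rational_functions :: "('r::tropical_semifield ^ 'n::finite \<Rightarrow> 'r) set" where
  "rational_functions = {poly_val H / poly_val G |H G. polynomial H \<and> polynomial G}"

text \<open>The kernel generated by the constant function \<open>\<alpha>\<close>; it is the same for all
  \<open>\<alpha> \<noteq> 1\<close>.\<close>

definition const_kernel ::
  "'r \<Rightarrow> ('r::tropical_semifield ^ 'n::finite \<Rightarrow> 'r) set" where
  "const_kernel \<alpha> = kernel rational_functions hull {\<lambda>_. \<alpha>}"

definition Skel :: "('r::tropical_semifield ^ 'n::finite \<Rightarrow> 'r) set \<Rightarrow> ('r ^ 'n) set" where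
  "Skel K = {a. \<forall>f\<in>K. f a = 1}"

definition regular :: "('r::tropical_semifield ^ 'n::finite \<Rightarrow> 'r) \<Rightarrow> bool" where
  "regular f \<longleftrightarrow> (\<exists>H G. polynomial H \<and> polynomial G \<and> f = poly_val H / poly_val G \<and>
     (\<forall>x. \<exists>h\<in>H. \<exists>g\<in>G. poly_val H x = monom_val h x \<and> poly_val G x = monom_val g x \<and> h \<noteq> g))"

definition regular_principal_kernels ::
  "('r::tropical_semifield ^ 'n::finite \<Rightarrow> 'r) set \<Rightarrow> ('r ^ 'n \<Rightarrow> 'r) set set" where
  "regular_principal_kernels S = {kernel S hull {f} |f. f \<in> S \<and> regular f}"


section \<open>Supertropical polynomials and corner loci\<close>

definition supertropical :: "('r, 'n) monomial multiset \<Rightarrow> bool" where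
  "supertropical f \<longleftrightarrow> f \<noteq> {#} \<and> (\<forall>m. count f m \<le> 2)"

definition tangible :: "('r, 'n) monomial multiset \<Rightarrow> bool" where
  "tangible f \<longleftrightarrow> (\<forall>m. count f m \<le> 1)"

definition corner_root ::
  "('r::tropical_semifield, 'n::finite) monomial multiset \<Rightarrow> 'r ^ 'n \<Rightarrow> bool" where
  "corner_root f a \<longleftrightarrow>
     (\<exists>m\<in>#f. \<exists>m'\<in>#f. m \<noteq> m' \<and>
        monom_val m a = poly_val (set_mset f) a \<and> monom_val m' a = poly_val (set_mset f) a) \<or>
     (\<exists>m. count f m = 2 \<and> monom_val m a = poly_val (set_mset f) a)"

definition Cor ::
  "('r::tropical_semifield, 'n::finite) monomial multiset set \<Rightarrow> ('r ^ 'n) set" where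
  "Cor F = {a. \<forall>f\<in>F. corner_root f a}"

text \<open>The generating families are nonempty: the empty family would make the whole space a
  regular corner locus, although it is not a common corner locus of tangible polynomials.\<close>

definition corner_loci :: "('r::tropical_semifield ^ 'n::finite) set set" where
  "corner_loci = {Cor F |F. finite F \<and> F \<noteq> {} \<and> (\<forall>f\<in>F. supertropical f)}"

definition regular_corner_loci :: "('r::tropical_semifield ^ 'n::finite) set set" where
  "regular_corner_loci =
     {Cor F |F. finite F \<and> F \<noteq> {} \<and> (\<forall>f\<in>F. supertropical f \<and> tangible f)}"


section \<open>Lattice correspondence\<close>

definition lattice_on ::
  "'a::order set \<Rightarrow> ('a \<Rightarrow> 'a \<Rightarrow> 'a) \<Rightarrow> ('a \<Rightarrow> 'a \<Rightarrow> 'a) \<Rightarrow> bool" where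
  "lattice_on L join meet \<longleftrightarrow> (\<forall>a\<in>L. \<forall>b\<in>L. join a b \<in> L \<and> meet a b \<in> L \<and>
     (\<forall>c\<in>L. (join a b \<le> c \<longleftrightarrow> a \<le> c \<and> b \<le> c) \<and> (c \<le> meet a b \<longleftrightarrow> c \<le> a \<and> c \<le> b)))"

text \<open>Larger kernels have smaller skeletons, so the correspondence exchanges joins and meets.\<close>

definition dual_lattice_iso ::
  "('a::order \<Rightarrow> 'b::order) \<Rightarrow> 'a set \<Rightarrow> ('a \<Rightarrow> 'a \<Rightarrow> 'a) \<Rightarrow> ('a \<Rightarrow> 'a \<Rightarrow> 'a) \<Rightarrow>
   'b set \<Rightarrow> ('b \<Rightarrow> 'b \<Rightarrow> 'b) \<Rightarrow> ('b \<Rightarrow> 'b \<Rightarrow> 'b) \<Rightarrow> bool" where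
  "dual_lattice_iso \<phi> L join meet L' join' meet' \<longleftrightarrow>
     lattice_on L join meet \<and> lattice_on L' join' meet' \<and> bij_betw \<phi> L L' \<and>
     (\<forall>a\<in>L. \<forall>b\<in>L. \<phi> (join a b) = meet' (\<phi> a) (\<phi> b) \<and> \<phi> (meet a b) = join' (\<phi> a) (\<phi> b))"

end

theory Submission
  imports Defs
begin

text \<open>
  Write \<open>|a|\<close> for \<open>a + inverse a\<close>, the maximum of \<open>a\<close> and its inverse. Since addition is the
  maximum, kernels are the convex subgroups closed under maxima; the principal kernel of \<open>f\<close>
  consists of the \<open>g\<close> with \<open>|g| \<le> |f|\<^sup>k\<close> for some \<open>k\<close>, and its skeleton is the set
  \<open>f = 1\<close>. In particular \<open>const_kernel \<alpha>\<close> is the semifield of bounded rational functions.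

  Injectivity of \<open>Skel\<close> is the statement that \<open>|g| \<le> |f|\<^sup>k\<close> for some \<open>k\<close> as soon as \<open>g\<close> is
  bounded and equals 1 wherever \<open>f\<close> does. In logarithmic coordinates \<open>|f|\<close> and \<open>|g|\<close> are
  piecewise linear, and on each of the finitely many closed polyhedral pieces Fourier--Motzkin
  elimination describes the image of \<open>(|f|, |g|)\<close> by finitely many non-strict linear
  inequalities in the plane, from which a linear bound is read off.

  The set where two polynomials \<open>H\<close> and \<open>G\<close> agree is cut out by the conditions \<open>h \<le> G\<close> and
  \<open>g \<le> H\<close> on their terms; each is the corner locus of one term plus the ghost of a polynomial.
  For regular \<open>f = H / G\<close> the set \<open>f = 1\<close> is the finite union of the cells on which terms
  \<open>h \<noteq> g\<close> agree and dominate \<open>H\<close> and \<open>G\<close>; each cell is a regular corner locus, and these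
  are closed under unions because the corner locus of a product is the union of the corner loci.
\<close>

section \<open>Bipotent semifields as linearly ordered groups\<close>

lemma right_inverse_sf [simp]: "a * inverse a = 1" for a :: "'a::semifield"
  by (metis mult.commute semifield_left_inverse)

lemma left_inverse_sf [simp]: "inverse a * a = 1" for a :: "'a::semifield"
  by (rule semifield_left_inverse)

lemma inverse_cancel_left_sf [simp]: "a * (inverse a * b) = b" "inverse a * (a * b) = b"
  for a :: "'a::semifield"
  by (metis mult.assoc mult.left_neutral left_inverse_sf right_inverse_sf)+

lemma mult_right_cancel_sf [simp]: "a * c = b * c \<longleftrightarrow> a = b" for a :: "'a::semifield"
  by (metis mult.assoc mult.right_neutral right_inverse_sf)

lemma mult_left_cancel_sf [simp]: "c * a = c * b \<longleftrightarrow> a = b" for a :: "'a::semifield"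
  by (metis mult.commute mult_right_cancel_sf)

lemma inverse_unique_sf: "a * b = 1 \<Longrightarrow> inverse a = b" for a :: "'a::semifield"
  by (metis mult_left_cancel_sf right_inverse_sf)

lemma inverse_inverse_sf [simp]: "inverse (inverse a) = a" for a :: "'a::semifield"
  by (rule inverse_unique_sf) simp

lemma inverse_one_sf [simp]: "inverse 1 = (1::'a::semifield)"
  by (rule inverse_unique_sf) simp

lemma inverse_fun_apply: "inverse f x = inverse (f x)" for f :: "'a \<Rightarrow> 'b::semifield"
  by (simp add: inverse_fun_def)

lemma inverse_mult_sf: "inverse (a * b) = inverse a * inverse b" for a :: "'a::semifield"
  by (rule inverse_unique_sf) (simp add: mult.assoc mult.left_commute[of b])

lemma divide_eq_iff_sf: "a / b = c \<longleftrightarrow> a = c * b" for a :: "'a::semifield"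
  using mult_right_cancel_sf[of "a * inverse b" b c]
  by (simp add: semifield_divide mult.assoc del: mult_right_cancel_sf)

lemma mult_le_cancel_right_sf [simp]: "a * c \<le> b * c \<longleftrightarrow> a \<le> b"
  for a :: "'a::bipotent_semifield"
  by (simp add: less_eq_iff_add flip: distrib_right)

lemma mult_le_cancel_left_sf [simp]: "c * a \<le> c * b \<longleftrightarrow> a \<le> b"
  for a :: "'a::bipotent_semifield"
  by (simp add: mult.commute[of c])

lemma mult_less_cancel_right_sf [simp]: "a * c < b * c \<longleftrightarrow> a < b"
  for a :: "'a::bipotent_semifield"
  by (simp only: less_le_not_le mult_le_cancel_right_sf)

lemma mult_mono_sf: "a \<le> b \<Longrightarrow> c \<le> d \<Longrightarrow> a * c \<le> b * d"
  for a :: "'a::bipotent_semifield"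
  by (rule order_trans[of _ "b * c"]) simp_all

lemma mult_strict_mono_sf: "a < b \<Longrightarrow> c \<le> d \<Longrightarrow> a * c < b * d"
  for a :: "'a::bipotent_semifield"
  by (rule order.strict_trans2[of _ "b * c"]) simp_all

lemma inverse_le_iff_sf [simp]: "inverse a \<le> inverse b \<longleftrightarrow> b \<le> a"
  for a :: "'a::bipotent_semifield"
proof -
  have "inverse a \<le> inverse b \<longleftrightarrow> inverse a * (a * b) \<le> inverse b * (a * b)"
    by (simp only: mult_le_cancel_right_sf)
  moreover have "inverse a * (a * b) = b" "inverse b * (a * b) = a"
    by (simp_all add: mult.left_commute[of "inverse b"])
  ultimately show ?thesis by simp
qed

lemma power_mono_sf: "a \<le> b \<Longrightarrow> a ^ n \<le> b ^ n" for a :: "'a::bipotent_semifield"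
  by (induction n) (auto intro: mult_mono_sf)

lemma power_strict_mono_sf: "a < b \<Longrightarrow> 0 < n \<Longrightarrow> a ^ n < b ^ n"
  for a :: "'a::bipotent_semifield"
  by (cases n) (simp_all add: mult_strict_mono_sf power_mono_sf)

lemma power_le_iff_sf: "0 < n \<Longrightarrow> a ^ n \<le> b ^ n \<longleftrightarrow> a \<le> b"
  for a :: "'a::bipotent_semifield"
  using power_strict_mono_sf[of b a n] power_mono_sf[of a b n] leD leI by blast

lemma one_le_power_sf: "1 \<le> a \<Longrightarrow> 1 \<le> a ^ n" for a :: "'a::bipotent_semifield"
  using power_mono_sf[of 1 a n] by simp

lemma one_le_mult_sf: "1 \<le> a \<Longrightarrow> 1 \<le> b \<Longrightarrow> 1 \<le> a * b" for a :: "'a::bipotent_semifield"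
  using mult_mono_sf[of 1 a 1 b] by simp

lemma power_increasing_sf: "1 \<le> a \<Longrightarrow> m \<le> n \<Longrightarrow> a ^ m \<le> a ^ n"
  for a :: "'a::bipotent_semifield"
  using mult_mono_sf[OF order_refl[of "a ^ m"] one_le_power_sf[of a "n - m"]]
  by (simp only: power_add[symmetric] le_add_diff_inverse mult_1_right)

text \<open>If every power of \<open>a\<close> stayed below \<open>b\<close>, the powers of
  \<open>inverse a\<close>, being at most 1, would stay below \<open>b\<close> too, and the axiom
  \<open>archimedean\<close> would force \<open>a = 1\<close>.\<close>

lemma archimedean_power:
  fixes a b :: "'a::tropical_semifield"
  assumes "1 < a"
  shows "\<exists>k. b \<le> a ^ k"
proof (rule ccontr)
  assume "\<not> ?thesis"
  then have less: "a ^ k < b" for k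
    by (meson leI)
  have "inverse a \<le> 1"
    using assms inverse_le_iff_sf[of a 1] by simp
  then have "inverse a ^ k \<le> 1" for k
    using power_mono_sf[of "inverse a" 1 k] by simp
  moreover have "1 \<le> b"
    using less[of 0] by simp
  ultimately have "a = 1"
    using less by (intro archimedean[of a b]) (auto intro: order.trans less_imp_le)
  then show False
    using assms by simp
qed

section \<open>The absolute value of a multiplicatively written ordered group\<close>

definition av :: "'a::semifield \<Rightarrow> 'a" where
  "av a = a + inverse a"

lemma av_eq_max: "av a = max a (inverse a)" for a :: "'a::bipotent_semifield"
  by (simp add: av_def add_eq_max)

lemma inverse_le_one_sf: "inverse a \<le> 1 \<longleftrightarrow> 1 \<le> a" for a :: "'a::bipotent_semifield"
  using inverse_le_iff_sf[of a 1] by simp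

lemma one_le_inverse_sf: "1 \<le> inverse a \<longleftrightarrow> a \<le> 1" for a :: "'a::bipotent_semifield"
  using inverse_le_iff_sf[of 1 a] by simp

lemma one_le_av: "1 \<le> av a" for a :: "'a::bipotent_semifield"
  using linear[of 1 a] by (simp add: av_eq_max le_max_iff_disj one_le_inverse_sf)

lemma av_le_iff: "av a \<le> b \<longleftrightarrow> a \<le> b \<and> inverse b \<le> a" for a :: "'a::bipotent_semifield"
  using inverse_le_iff_sf[of a "inverse b"] by (simp add: av_eq_max)

lemma av_eq_one_iff [simp]: "av a = 1 \<longleftrightarrow> a = 1" for a :: "'a::bipotent_semifield"
proof
  show "a = 1" if "av a = 1"
    using that av_le_iff[of a 1] by (simp add: order_antisym)
qed (simp add: av_eq_max)

lemma av_one [simp]: "av 1 = (1::'a::bipotent_semifield)"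
  by simp

lemma av_inverse [simp]: "av (inverse a) = av a" for a :: "'a::bipotent_semifield"
  by (simp add: av_eq_max max.commute)

lemma av_of_one_le: "1 \<le> a \<Longrightarrow> av a = a" for a :: "'a::bipotent_semifield"
  using order_trans[of "inverse a" 1 a] by (simp add: av_eq_max inverse_le_one_sf max.absorb1)

lemma le_av: "a \<le> av a" "inverse (av a) \<le> a" for a :: "'a::bipotent_semifield"
  using av_le_iff by blast+

lemma av_mult_le: "av (a * b) \<le> av a * av b" for a :: "'a::bipotent_semifield"
  by (simp add: av_le_iff inverse_mult_sf mult_mono_sf le_av)

lemma mult_eq_one_iff_sf: "1 \<le> a \<Longrightarrow> 1 \<le> b \<Longrightarrow> a * b = 1 \<longleftrightarrow> a = 1 \<and> b = 1"
  for a :: "'a::bipotent_semifield"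
  by (metis antisym mult.right_neutral mult_le_cancel_left_sf mult.left_neutral)

section \<open>Principal kernels\<close>

text \<open>Carriers for the kernel theory below, which is applied to all rational functions and
  again to \<open>const_kernel\<close>.\<close>

definition subsemifield :: "'a::semifield set \<Rightarrow> bool" where
  "subsemifield S \<longleftrightarrow> 1 \<in> S \<and> (\<forall>a\<in>S. \<forall>b\<in>S. a * b \<in> S \<and> a + b \<in> S) \<and> (\<forall>a\<in>S. inverse a \<in> S)"

lemma subsemifieldD:
  assumes "subsemifield S"
  shows "1 \<in> S" "a \<in> S \<Longrightarrow> b \<in> S \<Longrightarrow> a * b \<in> S" "a \<in> S \<Longrightarrow> b \<in> S \<Longrightarrow> a + b \<in> S"
    "a \<in> S \<Longrightarrow> inverse a \<in> S" "a \<in> S \<Longrightarrow> a ^ n \<in> S"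
proof -
  show *: "1 \<in> S" "a \<in> S \<Longrightarrow> b \<in> S \<Longrightarrow> a * b \<in> S" "a \<in> S \<Longrightarrow> b \<in> S \<Longrightarrow> a + b \<in> S"
    "a \<in> S \<Longrightarrow> inverse a \<in> S" for a b
    using assms by (auto simp: subsemifield_def)
  show "a \<in> S \<Longrightarrow> a ^ n \<in> S"
    by (induction n) (auto simp: *)
qed

text \<open>The exponent is the same for all points. With an exponent depending on the point the
  condition would, over an archimedean semifield, only say that \<open>g\<close> is 1 wherever
  \<open>f\<close> is; passing from that to a uniform exponent is the work of
  \<open>bounded_power_bound\<close>.\<close>

definition dominated :: "('a \<Rightarrow> 'r::bipotent_semifield) set \<Rightarrow> ('a \<Rightarrow> 'r) \<Rightarrow> ('a \<Rightarrow> 'r) set" where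
  "dominated S f = {g \<in> S. \<exists>k. \<forall>x. av (g x) \<le> av (f x) ^ k}"

lemma dominated_self: "f \<in> S \<Longrightarrow> f \<in> dominated S f"
  unfolding dominated_def by (auto intro: exI[of _ "1::nat"])

text \<open>Closure under \<open>x * a + y * b\<close> holds because \<open>x + y = 1\<close> makes
  the pointwise maximum of \<open>x\<close> and \<open>y\<close> equal to 1: both coefficients are
  at most 1, which bounds the value from above, and one of them equals 1, which bounds it from
  below.\<close>

lemma kernel_dominated:
  assumes S: "subsemifield S"
  shows "kernel S (dominated S f)"
  unfolding kernel_def
proof (intro conjI ballI impI)
  note S = subsemifieldD[OF S]
  show "dominated S f \<subseteq> S"
    by (auto simp: dominated_def)
  show "1 \<in> dominated S f"
    by (auto simp: dominated_def S(1) intro: exI[of _ "0::nat"])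
  fix a assume a: "a \<in> dominated S f"
  then obtain k where k: "a \<in> S" "\<And>x. av (a x) \<le> av (f x) ^ k"
    by (auto simp: dominated_def)
  show "inverse a \<in> dominated S f"
    using k by (auto simp: dominated_def S inverse_fun_apply)
  fix b assume b: "b \<in> dominated S f"
  then obtain l where l: "b \<in> S" "\<And>x. av (b x) \<le> av (f x) ^ l"
    by (auto simp: dominated_def)
  have "av (a x * b x) \<le> av (f x) ^ (k + l)" for x
    using av_mult_le[of "a x" "b x"] mult_mono_sf[OF k(2) l(2), of x x]
    by (simp add: power_add)
  then show "a * b \<in> dominated S f"
    using k(1) l(1) by (auto simp: dominated_def S)
  fix x y assume xy: "x \<in> S" "y \<in> S" "x + y = 1"
  have "av (x t * a t + y t * b t) \<le> av (f t) ^ (k + l)" (is "_ \<le> ?m") for t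
  proof -
    have m: "av (a t) \<le> ?m" "av (b t) \<le> ?m"
      by (meson k(2) l(2) le_add1 le_add2 one_le_av order_trans power_increasing_sf)+
    have 1: "max (x t) (y t) = 1"
      using fun_cong[OF xy(3), of t] by (simp add: add_eq_max)
    then have "x t \<le> 1" "y t \<le> 1" "x t = 1 \<or> y t = 1"
      by (metis max.cobounded1 max.cobounded2 max_def)+
    moreover have "a t \<le> ?m" "b t \<le> ?m"
      using m by (auto simp: av_le_iff)
    ultimately have "x t * a t \<le> ?m" "y t * b t \<le> ?m"
      using mult_mono_sf[of "x t" 1 "a t" ?m] mult_mono_sf[of "y t" 1 "b t" ?m] by auto
    then show ?thesis
      using m \<open>x t = 1 \<or> y t = 1\<close> by (auto simp: av_le_iff add_eq_max le_max_iff_disj)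
  qed
  then show "x * a + y * b \<in> dominated S f"
    using xy k(1) l(1) by (auto simp: dominated_def S)
qed

text \<open>For minimality, the convexity of a kernel has to be recovered from its closure under
  \<open>x * a + y * b\<close>, with a majorant \<open>F\<close> taken from the kernel.\<close>

lemma kernel_hull_eq:
  assumes S: "subsemifield S" and f: "f \<in> S"
  shows "kernel S hull {f} = dominated S f"
proof (rule hull_unique)
  show "{f} \<subseteq> dominated S f" "kernel S (dominated S f)"
    using assms by (auto simp: dominated_self kernel_dominated)
  note S = subsemifieldD[OF S]
  fix K assume fK: "{f} \<subseteq> K" and K: "kernel S K"
  have one: "1 \<in> K" and mult: "a \<in> K \<Longrightarrow> b \<in> K \<Longrightarrow> a * b \<in> K" and inv: "a \<in> K \<Longrightarrow> inverse a \<in> K"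
    and comb: "a \<in> K \<Longrightarrow> b \<in> K \<Longrightarrow> x \<in> S \<Longrightarrow> y \<in> S \<Longrightarrow> x + y = 1 \<Longrightarrow> x * a + y * b \<in> K"
    for a b x y
    using K by (auto simp: kernel_def)
  have add: "a \<in> K \<Longrightarrow> b \<in> K \<Longrightarrow> a + b \<in> K" for a b
    using comb[of a b 1 1] S(1) by (auto simp: fun_eq_iff add_eq_max)
  have pow: "a \<in> K \<Longrightarrow> a ^ n \<in> K" for a n
    by (induction n) (auto simp: one mult)
  show "dominated S f \<subseteq> K"
  proof
    fix g assume "g \<in> dominated S f"
    then obtain k where g: "g \<in> S" and k: "\<And>x. av (g x) \<le> av (f x) ^ k"
      by (auto simp: dominated_def)
    define F where "F = (f + inverse f) ^ k"
    have pw: "(h ^ n) x = h x ^ n" for h :: "'a \<Rightarrow> 'b" and n x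
      by (induction n) auto
    have Fx: "F x = av (f x) ^ k" for x
      by (simp add: F_def pw av_def inverse_fun_apply)
    have F: "F \<in> K" "F \<in> S"
      using fK f by (auto simp: F_def intro!: pow add inv S)
    \<comment> \<open>As 1 and \<open>h\<close> lie below \<open>F\<close>, the coefficient
      \<open>(h + 1) * inverse F\<close> is at most 1 and may be paired with the coefficient 1.
      Combining \<open>F\<close> and 1 in this way yields \<open>h + 1\<close>, because adding 1 a
      second time changes nothing.\<close>
    have *: "h + 1 \<in> K" if h: "h \<in> S" "\<And>x. h x \<le> F x" for h
    proof -
      have F1: "1 \<le> F x" for x
        by (simp add: Fx one_le_av one_le_power_sf)
      have le: "(h x + 1) * inverse (F x) \<le> 1" for x
        using mult_le_cancel_right_sf[of "h x + 1" "inverse (F x)" "F x"] h(2)[of x] F1[of x]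
        by (simp add: add_eq_max)
      have "((h + 1) * inverse F) * F + 1 * 1 \<in> K"
        using F one h(1) le
        by (intro comb S) (auto simp: fun_eq_iff inverse_fun_apply add_eq_max)
      moreover have "((h + 1) * inverse F) * F + 1 * 1 = h + 1"
        by (auto simp: fun_eq_iff inverse_fun_apply add_eq_max mult.assoc)
      ultimately show ?thesis by simp
    qed
    have "g + 1 \<in> K" "inverse g + 1 \<in> K"
      using k by (auto intro!: * g S simp: av_eq_max inverse_fun_apply Fx)
    \<comment> \<open>At each point one of the two factors is 1: \<open>g\<close> splits into its
      part above 1 and its part below 1.\<close>
    then have "(g + 1) * inverse (inverse g + 1) \<in> K"
      by (intro mult inv)
    also have "(g + 1) * inverse (inverse g + 1) = g"
    proof
      fix x
      show "((g + 1) * inverse (inverse g + 1)) x = g x"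
        using linear[of "g x" 1] inverse_le_one_sf[of "g x"] one_le_inverse_sf[of "g x"]
        by (auto simp: inverse_fun_apply add_eq_max max.absorb1 max.absorb2)
    qed
    finally show "g \<in> K" .
  qed
qed

lemma dominated_Int:
  assumes S: "subsemifield S" and fg: "f \<in> S" "g \<in> S"
  shows "\<exists>h\<in>S. dominated S f \<inter> dominated S g = dominated S h \<and>
    {x. h x = 1} = {x. f x = 1} \<union> {x. g x = 1}"
proof (intro bexI conjI)
  note S = subsemifieldD[OF S]
  \<comment> \<open>The minimum of the two absolute values, obtained from the maximum by taking
    inverses.\<close>
  define h where "h = inverse (inverse (f + inverse f) + inverse (g + inverse g))"
  show "h \<in> S"
    unfolding h_def using fg by (intro S)
  have h1: "h x = min (av (f x)) (av (g x))" for x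
  proof -
    have "h x = inverse (max (inverse (av (f x))) (inverse (av (g x))))"
      by (simp add: h_def inverse_fun_apply av_def add_eq_max)
    then show ?thesis
      by (auto simp: max_def min_def)
  qed
  then have h: "av (h x) = min (av (f x)) (av (g x))" for x
    by (simp add: av_of_one_le one_le_av)
  have "h x = 1 \<longleftrightarrow> f x = 1 \<or> g x = 1" for x
    using one_le_av[of "f x"] one_le_av[of "g x"] order_antisym[of 1] unfolding h1
    by (metis av_eq_one_iff min.absorb1 min.absorb2 min_def)
  then show "{x. h x = 1} = {x. f x = 1} \<union> {x. g x = 1}"
    by blast
  show "dominated S f \<inter> dominated S g = dominated S h"
  proof (intro equalityI subsetI)
    fix a assume "a \<in> dominated S f \<inter> dominated S g"
    then obtain k l where a: "a \<in> S" and kl: "\<And>x. av (a x) \<le> av (f x) ^ k" "\<And>x. av (a x) \<le> av (g x) ^ l"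
      by (auto simp: dominated_def)
    have "av (a x) \<le> av (f x) ^ (k + l)" "av (a x) \<le> av (g x) ^ (k + l)" for x
      by (meson kl le_add1 le_add2 one_le_av order_trans power_increasing_sf)+
    then have "av (a x) \<le> av (h x) ^ (k + l)" for x
      by (simp add: h min_def)
    then show "a \<in> dominated S h"
      using a by (auto simp: dominated_def)
  next
    fix a assume "a \<in> dominated S h"
    moreover have "av (h x) ^ k \<le> av (f x) ^ k" "av (h x) ^ k \<le> av (g x) ^ k" for x k
      by (auto simp: h intro: power_mono_sf)
    ultimately show "a \<in> dominated S f \<inter> dominated S g"
      unfolding dominated_def by (blast intro: order_trans)
  qed
qed

lemma dominated_times:
  assumes S: "subsemifield S" and fg: "f \<in> S" "g \<in> S"
  shows "\<exists>h\<in>S. dominated S f * dominated S g = dominated S h \<and>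
    {x. h x = 1} = {x. f x = 1} \<inter> {x. g x = 1}"
proof (intro bexI conjI)
  note S' = subsemifieldD[OF S]
  \<comment> \<open>Absolute values are taken before multiplying so that \<open>f\<close> and
    \<open>g\<close> cannot cancel each other: the product is 1 only where both are.\<close>
  define h where "h = (f + inverse f) * (g + inverse g)"
  show "h \<in> S"
    unfolding h_def using fg by (intro S')
  have hx: "h x = av (f x) * av (g x)" for x
    by (simp add: h_def av_def inverse_fun_apply)
  have h: "av (h x) = av (f x) * av (g x)" for x
    by (simp add: hx av_of_one_le one_le_av one_le_mult_sf)
  show "{x. h x = 1} = {x. f x = 1} \<inter> {x. g x = 1}"
    by (simp add: hx mult_eq_one_iff_sf one_le_av Collect_conj_eq)
  show "dominated S f * dominated S g = dominated S h"
  proof (intro equalityI subsetI)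
    fix c assume "c \<in> dominated S f * dominated S g"
    then obtain a b k l where ab: "c = a * b" "a \<in> S" "b \<in> S"
      and kl: "\<And>x. av (a x) \<le> av (f x) ^ k" "\<And>x. av (b x) \<le> av (g x) ^ l"
      by (auto simp: dominated_def elim!: set_times_elim)
    have "av (a x) \<le> av (f x) ^ (k + l)" "av (b x) \<le> av (g x) ^ (k + l)" for x
      by (meson kl le_add1 le_add2 one_le_av order_trans power_increasing_sf)+
    then have "av (c x) \<le> av (h x) ^ (k + l)" for x
      unfolding h ab(1) power_mult_distrib times_fun_apply
      by (meson av_mult_le mult_mono_sf order_trans)
    then show "c \<in> dominated S h"
      using ab S' by (auto simp: dominated_def)
  next
    fix c assume "c \<in> dominated S h"
    then obtain k where c: "c \<in> S" and k: "\<And>x. av (c x) \<le> (av (f x) * av (g x)) ^ k"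
      by (auto simp: dominated_def h)
    define F G where "F = (f + inverse f) ^ k" and "G = (g + inverse g) ^ k"
    have pw: "(h ^ n) x = h x ^ n" for h :: "'a \<Rightarrow> 'b" and n x
      by (induction n) auto
    have Fx: "F x = av (f x) ^ k" and Gx: "G x = av (g x) ^ k" for x
      by (simp_all add: F_def G_def pw av_def inverse_fun_apply)
    have F: "F \<in> S"
      using fg by (auto simp: F_def intro!: S')
    \<comment> \<open>Truncating \<open>c\<close> to the interval from \<open>inverse F\<close> to \<open>F\<close> gives the first factor.\<close>
    define a where "a = inverse (inverse c + inverse F) + inverse F"
    have aS: "a \<in> S"
      unfolding a_def using c F by (intro S')
    have ax: "a x = max (min (c x) (F x)) (inverse (F x))" for x
    proof -
      have "inverse (max (inverse (c x)) (inverse (F x))) = min (c x) (F x)"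
        by (auto simp: max_def min_def)
      then show ?thesis
        by (simp add: a_def inverse_fun_apply add_eq_max)
    qed
    have "1 \<le> F x" "1 \<le> G x" for x
      by (auto simp: Fx Gx one_le_av one_le_power_sf)
    then have F1: "inverse (F x) \<le> F x" "1 \<le> F x" "1 \<le> G x" for x
      using inverse_le_one_sf order_trans by blast+
    have 1: "av (a x) \<le> F x" for x
      using F1 by (auto simp: av_le_iff ax)
    have 2: "av (c x * inverse (a x)) \<le> G x" for x
    proof -
      have k1: "c x \<le> F x * G x" "inverse (F x) * inverse (G x) \<le> c x"
        using k[of x] by (auto simp: av_le_iff power_mult_distrib Fx Gx inverse_mult_sf)
      \<comment> \<open>Where the truncation leaves \<open>c\<close> unchanged the quotient is 1;
        where it acts, \<open>c\<close> leaves the interval by a factor of at most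
        \<open>G\<close>.\<close>
      consider "c x \<le> inverse (F x)" "a x = inverse (F x)" | "F x \<le> c x" "a x = F x"
        | "a x = c x"
        using F1(1)[of x] linear[of "c x" "F x"] linear[of "c x" "inverse (F x)"]
        unfolding ax by (metis max.absorb1 max.absorb2 min.absorb1 min.absorb2)
      then show ?thesis
      proof cases
        case 1
        have "c x * F x \<le> inverse (F x) * F x"
          using 1 by (simp only: mult_le_cancel_right_sf)
        moreover have "inverse (F x) * inverse (G x) * F x \<le> c x * F x"
          using k1 by (simp only: mult_le_cancel_right_sf)
        ultimately show ?thesis
          using 1 F1(3)[of x] by (auto simp: av_le_iff mult_ac)
      next
        case 2
        have "c x * inverse (F x) \<le> F x * G x * inverse (F x)"
          using k1 by (simp only: mult_le_cancel_right_sf)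
        moreover have "F x * inverse (F x) \<le> c x * inverse (F x)"
          using 2 by (simp only: mult_le_cancel_right_sf)
        ultimately show ?thesis
          using 2 F1(3)[of x] order_trans[of "inverse (G x)" 1]
          by (auto simp: av_le_iff inverse_le_one_sf mult.assoc mult.left_commute[of "F x"])
      next
        case 3
        then show ?thesis
          using F1(3)[of x] by simp
      qed
    qed
    have "c = a * (c * inverse a)"
      by (auto simp: fun_eq_iff inverse_fun_apply mult.left_commute[of _ "c _"])
    moreover have "a \<in> dominated S f" "c * inverse a \<in> dominated S g"
      using 1 2 aS c S' by (auto simp: dominated_def Fx Gx inverse_fun_apply)
    ultimately show "c \<in> dominated S f * dominated S g"
      by (metis set_times_intro)
  qed
qed

text \<open>Where \<open>f\<close> is 1, domination squeezes \<open>av (g x)\<close> between 1 and a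
  power of 1.\<close>

lemma Skel_dominated:
  assumes "f \<in> S"
  shows "Skel (dominated S f) = {x. f x = 1}"
proof -
  have "g x = 1" if "g \<in> dominated S f" "f x = 1" for g x
  proof -
    obtain k where "av (g x) \<le> av (f x) ^ k"
      using \<open>g \<in> _\<close> by (auto simp: dominated_def)
    then show ?thesis
      by (metis \<open>f x = 1\<close> av_eq_one_iff one_le_av order_antisym power_one)
  qed
  then show ?thesis
    using dominated_self[OF assms] by (auto simp: Skel_def)
qed

section \<open>Fourier--Motzkin elimination\<close>

text \<open>The largest lower bound serves or, if there is none, the smallest upper bound;
  \<open>Max\<close> and \<open>Min\<close> give no information on empty sets, hence the case
  split.\<close>

lemma ex_between:
  fixes f :: "'c \<Rightarrow> 'a::linorder"
  assumes "finite L" "finite U" "\<And>l u. l \<in> L \<Longrightarrow> u \<in> U \<Longrightarrow> f l \<le> f u"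
  shows "\<exists>t. (\<forall>l\<in>L. f l \<le> t) \<and> (\<forall>u\<in>U. t \<le> f u)"
proof (cases "L = {}")
  case False
  then show ?thesis
    using assms by (intro exI[of _ "Max (f ` L)"]) auto
next
  case True
  show ?thesis
  proof (cases "U = {}")
    case False
    then show ?thesis
      using assms True by (intro exI[of _ "Min (f ` U)"]) auto
  qed (use True in auto)
qed

lemma ex_root:
  fixes c d :: "'r::tropical_semifield"
  assumes "0 < n"
  shows "\<exists>t. t ^ n * d = c"
proof -
  obtain t where "t ^ n = c * inverse d"
    using divisible[OF assms] by blast
  then show ?thesis
    by (intro exI[of _ t]) (simp add: mult.assoc)
qed

lemma mult_power_le_iff_sf:
  fixes a b t :: "'r::bipotent_semifield"
  shows "q \<le> p \<Longrightarrow> a * t ^ p \<le> b * t ^ q \<longleftrightarrow> a * t ^ (p - q) \<le> b"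
    and "p \<le> q \<Longrightarrow> a * t ^ p \<le> b * t ^ q \<longleftrightarrow> a \<le> b * t ^ (q - p)"
proof -
  show "a * t ^ p \<le> b * t ^ q \<longleftrightarrow> a * t ^ (p - q) \<le> b" if "q \<le> p"
  proof -
    have "t ^ p = t ^ (p - q) * t ^ q"
      using that by (simp flip: power_add)
    then show ?thesis
      by (simp flip: mult.assoc)
  qed
  show "a * t ^ p \<le> b * t ^ q \<longleftrightarrow> a \<le> b * t ^ (q - p)" if "p \<le> q"
  proof -
    have "t ^ q = t ^ (q - p) * t ^ p"
      using that by (simp flip: power_add)
    then show ?thesis
      by (simp flip: mult.assoc)
  qed
qed

text \<open>Inequalities with \<open>q c < p c\<close> bound \<open>t\<close> from above, those with
  \<open>p c < q c\<close> from below, and the others are free of \<open>t\<close> after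
  cancellation. A common solution exists exactly if each lower bound is at most each upper bound.
  These bounds are roots, available by divisibility; comparing suitable powers of them removes the
  roots again.\<close>

lemma eliminate_variable:
  fixes a b :: "'c \<Rightarrow> 'r::tropical_semifield" and p q :: "'c \<Rightarrow> nat"
  assumes fin: "finite C"
  shows "(\<exists>t. \<forall>c\<in>C. a c * t ^ p c \<le> b c * t ^ q c) \<longleftrightarrow>
    (\<forall>c\<in>C. p c = q c \<longrightarrow> a c \<le> b c) \<and>
    (\<forall>c\<in>C. \<forall>d\<in>C. q c < p c \<longrightarrow> p d < q d \<longrightarrow>
      a c ^ (q d - p d) * a d ^ (p c - q c) \<le> b c ^ (q d - p d) * b d ^ (p c - q c))"
    (is "?L \<longleftrightarrow> ?R")
proof
  assume ?L
  then obtain t where t: "\<And>c. c \<in> C \<Longrightarrow> a c * t ^ p c \<le> b c * t ^ q c"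
    by blast
  show ?R
  proof (intro conjI ballI impI)
    show "a c \<le> b c" if "c \<in> C" "p c = q c" for c
      using t[OF that(1)] that(2) by simp
    fix c d assume cd: "c \<in> C" "d \<in> C" "q c < p c" "p d < q d"
    define P Q where "P = p c - q c" and "Q = q d - p d"
    have "a c * t ^ P \<le> b c" "a d \<le> b d * t ^ Q"
      using t[OF cd(1)] t[OF cd(2)] cd by (auto simp: P_def Q_def mult_power_le_iff_sf)
    \<comment> \<open>These powers make the exponent of \<open>t\<close> equal to
      \<open>P * Q\<close> on both sides, so that \<open>t\<close> cancels.\<close>
    then have "(a c * t ^ P) ^ Q * a d ^ P \<le> b c ^ Q * (b d * t ^ Q) ^ P"
      by (intro mult_mono_sf power_mono_sf)
    then have "(a c ^ Q * a d ^ P) * t ^ (P * Q) \<le> (b c ^ Q * b d ^ P) * t ^ (P * Q)"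
      by (simp add: power_mult_distrib mult_ac flip: power_mult)
    then show "a c ^ (q d - p d) * a d ^ (p c - q c) \<le> b c ^ (q d - p d) * b d ^ (p c - q c)"
      by (simp add: P_def Q_def)
  qed
next
  assume R: ?R
  \<comment> \<open>The threshold at which inequality \<open>c\<close> becomes an equality; it is
    the upper or lower bound that \<open>c\<close> imposes on \<open>t\<close>.\<close>
  have "\<exists>t. (q c < p c \<longrightarrow> t ^ (p c - q c) * a c = b c) \<and> (p c < q c \<longrightarrow> t ^ (q c - p c) * b c = a c)"
    for c
  proof (cases "q c < p c")
    case True
    then show ?thesis
      using ex_root[of "p c - q c" "a c" "b c"] by auto
  next
    case False
    then show ?thesis
      using ex_root[of "q c - p c" "b c" "a c"] by auto
  qed
  then obtain r where r: "\<And>c. q c < p c \<Longrightarrow> r c ^ (p c - q c) * a c = b c"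
    "\<And>c. p c < q c \<Longrightarrow> r c ^ (q c - p c) * b c = a c"
    by metis
  have le: "r d \<le> r c" if cd: "c \<in> C" "d \<in> C" "q c < p c" "p d < q d" for c d
  proof -
    define P Q where "P = p c - q c" and "Q = q d - p d"
    have PQ: "0 < P * Q"
      using cd by (simp add: P_def Q_def)
    have "a c ^ Q * a d ^ P \<le> b c ^ Q * b d ^ P"
      using R cd by (auto simp: P_def Q_def)
    also have "a d = r d ^ Q * b d"
      using r(2)[OF cd(4)] by (simp add: Q_def)
    also have "b c = r c ^ P * a c"
      using r(1)[OF cd(3)] by (simp add: P_def)
    finally have "r d ^ (P * Q) * (a c ^ Q * b d ^ P) \<le> r c ^ (P * Q) * (a c ^ Q * b d ^ P)"
      by (simp add: power_mult_distrib mult_ac flip: power_mult)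
    then show ?thesis
      using PQ by (simp add: power_le_iff_sf del: nat_0_less_mult_iff)
  qed
  have "\<exists>t. (\<forall>d\<in>{d\<in>C. p d < q d}. r d \<le> t) \<and> (\<forall>c\<in>{c\<in>C. q c < p c}. t \<le> r c)"
    by (rule ex_between) (use fin le in auto)
  then obtain t where t: "\<And>d. d \<in> C \<Longrightarrow> p d < q d \<Longrightarrow> r d \<le> t" "\<And>c. c \<in> C \<Longrightarrow> q c < p c \<Longrightarrow> t \<le> r c"
    by blast
  show ?L
  proof (intro exI ballI)
    fix c assume c: "c \<in> C"
    consider "p c = q c" | "q c < p c" | "p c < q c"
      using nat_neq_iff by blast
    then show "a c * t ^ p c \<le> b c * t ^ q c"
    proof cases
      case 1
      then show ?thesis
        using R c by simp
    next
      case 2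
      have "t ^ (p c - q c) * a c \<le> r c ^ (p c - q c) * a c"
        using t(2)[OF c 2] by (simp add: power_mono_sf)
      also have "\<dots> = b c"
        using r(1)[OF 2] .
      finally show ?thesis
        using 2 by (simp add: mult_power_le_iff_sf mult.commute)
    next
      case 3
      have "r c ^ (q c - p c) * b c \<le> t ^ (q c - p c) * b c"
        using t(1)[OF c 3] by (simp add: power_mono_sf)
      also have "r c ^ (q c - p c) * b c = a c"
        using r(2)[OF 3] .
      finally show ?thesis
        using 3 by (simp add: mult_power_le_iff_sf mult.commute)
    qed
  qed
qed

section \<open>Monomials and systems of monomial inequalities\<close>

definition monom_mult :: "('r::tropical_semifield, 'n) monomial \<Rightarrow> ('r, 'n) monomial \<Rightarrow> ('r, 'n) monomial" where
  "monom_mult m m' = (fst m * fst m', \<lambda>i. snd m i + snd m' i)"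

definition monom_pow :: "('r::tropical_semifield, 'n) monomial \<Rightarrow> nat \<Rightarrow> ('r, 'n) monomial" where
  "monom_pow m k = (fst m ^ k, \<lambda>i. k * snd m i)"

definition monom_drop :: "'n \<Rightarrow> ('r, 'n) monomial \<Rightarrow> ('r, 'n) monomial" where
  "monom_drop j m = (fst m, (snd m)(j := 0))"

lemma monom_val_mult: "monom_val (monom_mult m m') x = monom_val m x * monom_val m' x"
  by (simp add: monom_val_def monom_mult_def power_add prod.distrib mult_ac)

lemma monom_val_pow: "monom_val (monom_pow m k) x = monom_val m x ^ k"
proof (induction k)
  case (Suc k)
  have "monom_pow m (Suc k) = monom_mult m (monom_pow m k)"
    by (simp add: monom_pow_def monom_mult_def)
  then show ?case
    using Suc by (simp add: monom_val_mult)
qed (simp add: monom_val_def monom_pow_def)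

lemma monom_val_cong:
  assumes "\<And>i. snd m i \<noteq> 0 \<Longrightarrow> x $ i = y $ i"
  shows "monom_val m x = monom_val m y"
proof -
  have "(x $ i) ^ snd m i = (y $ i) ^ snd m i" for i
    using assms[of i] by (cases "snd m i = 0") auto
  then show ?thesis
    by (simp add: monom_val_def)
qed

lemma monom_val_drop: "monom_val m x = monom_val (monom_drop j m) x * (x $ j) ^ snd m j"
proof -
  have "(\<Prod>i\<in>UNIV. (x $ i) ^ snd m i) = (x $ j) ^ snd m j * (\<Prod>i\<in>UNIV-{j}. (x $ i) ^ snd m i)"
    by (simp add: prod.remove)
  moreover have "(\<Prod>i\<in>UNIV. (x $ i) ^ snd (monom_drop j m) i) = (\<Prod>i\<in>UNIV-{j}. (x $ i) ^ snd m i)"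
    by (subst prod.remove[of _ j]) (auto simp: monom_drop_def intro: prod.cong)
  ultimately show ?thesis
    by (simp add: monom_val_def monom_drop_def mult_ac)
qed

text \<open>Each pair is a non-strict inequality that is affine in logarithmic coordinates, so a
  finite \<open>C\<close> describes a closed polyhedron. Monomials on both sides make up for the
  absence of negative exponents.\<close>

definition satisfies :: "(('r::tropical_semifield, 'n::finite) monomial \<times> ('r, 'n) monomial) set \<Rightarrow> 'r ^ 'n \<Rightarrow> bool" where
  "satisfies C x \<longleftrightarrow> (\<forall>c\<in>C. monom_val (fst c) x \<le> monom_val (snd c) x)"

lemma ball_UN_image:
  "(\<forall>z\<in>(\<Union>c\<in>{c\<in>C. P c}. f c ` {d\<in>C. Q d}). R z) \<longleftrightarrow>
    (\<forall>c\<in>C. \<forall>d\<in>C. P c \<longrightarrow> Q d \<longrightarrow> R (f c d))"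
  by auto

text \<open>Products and powers of monomials are monomials, so the conditions from
  \<open>eliminate_variable\<close> form a system of the same kind and the elimination can be
  repeated. \<open>D1\<close> collects the inequalities free of the variable, \<open>D2\<close> the
  comparisons of lower with upper bounds.\<close>

lemma eliminate_one:
  fixes C :: "(('r::tropical_semifield, 'n::finite) monomial \<times> ('r, 'n) monomial) set"
  assumes fin: "finite C"
  shows "\<exists>D. finite D \<and>
    (\<forall>x. satisfies D x \<longleftrightarrow> (\<exists>t. satisfies C (\<chi> i. if i = j then t else x $ i)))"
proof -
  define p q where "p c = snd (fst c) j" and "q c = snd (snd c) j"
    for c :: "('r, 'n) monomial \<times> ('r, 'n) monomial"
  define a b where "a c = monom_drop j (fst c)" and "b c = monom_drop j (snd c)"
    for c :: "('r, 'n) monomial \<times> ('r, 'n) monomial"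
  define D1 where "D1 = (\<lambda>c. (a c, b c)) ` {c\<in>C. p c = q c}"
  define D2 where "D2 = (\<Union>c\<in>{c\<in>C. q c < p c}. (\<lambda>d.
      (monom_mult (monom_pow (a c) (q d - p d)) (monom_pow (a d) (p c - q c)),
       monom_mult (monom_pow (b c) (q d - p d)) (monom_pow (b d) (p c - q c)))) ` {d\<in>C. p d < q d})"
  have 1: "finite (D1 \<union> D2)"
    using fin by (simp add: D1_def D2_def)
  have 2: "satisfies (D1 \<union> D2) x \<longleftrightarrow> (\<exists>t. satisfies C (\<chi> i. if i = j then t else x $ i))" for x
  proof -
    have drop: "monom_val (monom_drop j m) (\<chi> i. if i = j then t else x $ i) = monom_val (monom_drop j m) x"
      for m t
      by (rule monom_val_cong) (auto simp: monom_drop_def)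
    have val: "monom_val m (\<chi> i. if i = j then t else x $ i) = monom_val (monom_drop j m) x * t ^ snd m j"
      for m t
      by (subst monom_val_drop[of _ _ j]) (simp add: drop)
    have "satisfies C (\<chi> i. if i = j then t else x $ i) \<longleftrightarrow>
      (\<forall>c\<in>C. monom_val (a c) x * t ^ p c \<le> monom_val (b c) x * t ^ q c)" for t
      unfolding satisfies_def val a_def b_def p_def q_def ..
    then have "(\<exists>t. satisfies C (\<chi> i. if i = j then t else x $ i)) \<longleftrightarrow>
      (\<exists>t. \<forall>c\<in>C. monom_val (a c) x * t ^ p c \<le> monom_val (b c) x * t ^ q c)"
      by (simp only:)
    also have "\<dots> \<longleftrightarrow> satisfies (D1 \<union> D2) x"
    proof -
      have "satisfies D1 x \<longleftrightarrow> (\<forall>c\<in>C. p c = q c \<longrightarrow> monom_val (a c) x \<le> monom_val (b c) x)"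
        unfolding satisfies_def D1_def by auto
      moreover have "satisfies D2 x \<longleftrightarrow> (\<forall>c\<in>C. \<forall>d\<in>C. q c < p c \<longrightarrow> p d < q d \<longrightarrow>
          monom_val (a c) x ^ (q d - p d) * monom_val (a d) x ^ (p c - q c) \<le>
          monom_val (b c) x ^ (q d - p d) * monom_val (b d) x ^ (p c - q c))"
        unfolding satisfies_def D2_def ball_UN_image
        by (simp only: fst_conv snd_conv monom_val_mult monom_val_pow)
      moreover have "satisfies (D1 \<union> D2) x \<longleftrightarrow> satisfies D1 x \<and> satisfies D2 x"
        unfolding satisfies_def by blast
      ultimately show ?thesis
        unfolding eliminate_variable[OF fin, of "\<lambda>c. monom_val (a c) x" p "\<lambda>c. monom_val (b c) x" q]
        by (simp only:)
    qed
    finally show ?thesis by simp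
  qed
  show ?thesis
    by (rule exI[of _ "D1 \<union> D2"], intro conjI allI) (rule 1 2)+
qed

text \<open>The right-hand side sees \<open>x\<close> only outside \<open>J\<close>, so
  \<open>D\<close> describes the projection of the polyhedron that forgets the coordinates in
  \<open>J\<close>.\<close>

lemma eliminate_variables:
  fixes C :: "(('r::tropical_semifield, 'n::finite) monomial \<times> ('r, 'n) monomial) set"
  assumes "finite C"
  shows "\<exists>D. finite D \<and>
    (\<forall>x. satisfies D x \<longleftrightarrow> (\<exists>y. (\<forall>i. i \<notin> J \<longrightarrow> y $ i = x $ i) \<and> satisfies C y))"
proof (induction J rule: finite_induct[OF finite])
  case 1
  then show ?case
    using assms by (intro exI[of _ C]) (auto simp flip: vec_eq_iff)
next
  case (2 j J)
  then obtain D where D: "finite D"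
    "\<And>x. satisfies D x \<longleftrightarrow> (\<exists>y. (\<forall>i. i \<notin> J \<longrightarrow> y $ i = x $ i) \<and> satisfies C y)"
    by blast
  obtain E where E: "finite E"
    "\<And>x. satisfies E x \<longleftrightarrow> (\<exists>t. satisfies D (\<chi> i. if i = j then t else x $ i))"
    using eliminate_one[OF D(1), of j] by blast
  have "satisfies E x \<longleftrightarrow> (\<exists>y. (\<forall>i. i \<notin> insert j J \<longrightarrow> y $ i = x $ i) \<and> satisfies C y)" for x
  proof -
    have "satisfies E x \<longleftrightarrow>
      (\<exists>t y. (\<forall>i. i \<notin> J \<longrightarrow> y $ i = (if i = j then t else x $ i)) \<and> satisfies C y)"
      by (simp add: E(2) D(2))
    also have "\<dots> \<longleftrightarrow> (\<exists>y. (\<forall>i. i \<notin> insert j J \<longrightarrow> y $ i = x $ i) \<and> satisfies C y)"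
    proof
      assume "\<exists>y. (\<forall>i. i \<notin> insert j J \<longrightarrow> y $ i = x $ i) \<and> satisfies C y"
      then obtain y where "\<forall>i. i \<notin> insert j J \<longrightarrow> y $ i = x $ i" "satisfies C y"
        by blast
      then show "\<exists>t y. (\<forall>i. i \<notin> J \<longrightarrow> y $ i = (if i = j then t else x $ i)) \<and> satisfies C y"
        by (intro exI[of _ "y $ j"] exI[of _ y]) auto
    next
      assume "\<exists>t y. (\<forall>i. i \<notin> J \<longrightarrow> y $ i = (if i = j then t else x $ i)) \<and> satisfies C y"
      then obtain t y where "\<And>i. i \<notin> J \<Longrightarrow> y $ i = (if i = j then t else x $ i)" "satisfies C y"
        by blast
      then show "\<exists>y. (\<forall>i. i \<notin> insert j J \<longrightarrow> y $ i = x $ i) \<and> satisfies C y"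
        by (intro exI[of _ y]) simp
    qed
    finally show ?thesis .
  qed
  with E(1) show ?case
    by (intro exI[of _ E] conjI allI)
qed

section \<open>Bounded functions vanishing on a skeleton\<close>

text \<open>Provides a value above 1, yet so close to 1 that none of finitely many margins
  \<open>d i\<close> is exceeded. The element \<open>\<alpha>\<close> supplies some value above 1 to
  start from.\<close>

lemma ex_small_power:
  fixes d :: "'i \<Rightarrow> 'r::tropical_semifield"
  assumes "finite I" "\<And>i. i \<in> I \<Longrightarrow> 1 < d i" "(\<alpha>::'r) \<noteq> 1"
  shows "\<exists>v. 1 < v \<and> (\<forall>i\<in>I. v ^ n i \<le> d i)"
  using assms(1,2)
proof (induction I rule: finite_induct)
  case empty
  show ?case
    using assms(3) one_le_av[of \<alpha>] by (intro exI[of _ "av \<alpha>"]) (auto simp: less_le)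
next
  case (insert i I)
  then obtain v where v: "1 < v" "\<forall>i\<in>I. v ^ n i \<le> d i"
    by auto
  \<comment> \<open>A root of order \<open>Suc (n i)\<close> exists even for \<open>n i = 0\<close>;
    as \<open>w\<close> exceeds 1, its smaller power \<open>w ^ n i\<close> is at most
    \<open>d i\<close>.\<close>
  obtain w where w: "w ^ Suc (n i) = d i"
    using divisible[of "Suc (n i)" "d i"] by auto
  have w1: "1 < w"
  proof (rule ccontr)
    assume "\<not> 1 < w"
    then have "w ^ Suc (n i) \<le> 1 ^ Suc (n i)"
      by (intro power_mono_sf) simp
    then show False
      using insert.prems[of i] w by simp
  qed
  have "min v w ^ n i \<le> w ^ n i"
    by (rule power_mono_sf) simp
  also have "\<dots> \<le> d i"
    unfolding w[symmetric] using w1 by (intro power_increasing_sf) auto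
  finally have "min v w ^ n i \<le> d i" .
  moreover have "min v w ^ n k \<le> d k" if "k \<in> I" for k
    using v(2) that by (meson min.cobounded1 order_trans power_mono_sf)
  ultimately show ?case
    using v(1) w1 by (intro exI[of _ "min v w"]) auto
qed

text \<open>In logarithmic coordinates \<open>R\<close> is a closed polyhedral region in the plane
  on which \<open>v\<close> is bounded, and it meets the line \<open>u = 1\<close> at most in the
  point \<open>(1, 1)\<close>. If it contains this point, an edge through it bounds \<open>v\<close>
  by a power of \<open>u\<close>; otherwise \<open>u\<close> stays away from 1 and a power of it
  reaches \<open>M\<close>.\<close>

lemma planar_bound:
  fixes c c' :: "'d \<Rightarrow> 'r::tropical_semifield" and a b a' b' :: "'d \<Rightarrow> nat"
  assumes fin: "finite D"
    and R: "\<And>u v. R u v \<longleftrightarrow> (\<forall>d\<in>D. (c d * u ^ a d) * v ^ b d \<le> (c' d * u ^ a' d) * v ^ b' d)"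
    and bounds: "\<And>u v. R u v \<Longrightarrow> 1 \<le> u \<and> 1 \<le> v \<and> v \<le> M"
    and one: "\<And>v. R 1 v \<Longrightarrow> v = 1"
    and \<alpha>: "(\<alpha>::'r) \<noteq> 1"
  shows "\<exists>k. \<forall>u v. R u v \<longrightarrow> v \<le> u ^ k"
proof (cases "R 1 1")
  case True
  have cc: "c d \<le> c' d" if "d \<in> D" for d
    using True that unfolding R by force
  \<comment> \<open>A constraint that is tight at \<open>(1, 1)\<close> and bounds \<open>v\<close>
    from above. Without one, all upper bounds would have slack there, and \<open>R 1 v\<close> would
    hold for some \<open>v\<close> above 1.\<close>
  have "\<exists>d\<in>D. b' d < b d \<and> c d = c' d"
  proof (rule ccontr)
    assume "\<not> ?thesis"
    then have less: "c d < c' d" if "d \<in> D" "b' d < b d" for d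
      using that cc[of d] by (auto simp: order.order_iff_strict)
    have "1 < c' d * inverse (c d)" if "d \<in> D" "b' d < b d" for d
      using mult_less_cancel_right_sf[of 1 "c d" "c' d * inverse (c d)"] less[OF that]
      by (simp add: mult.assoc)
    then obtain v where v: "1 < v" "\<And>d. d \<in> D \<Longrightarrow> b' d < b d \<Longrightarrow> v ^ (b d - b' d) \<le> c' d * inverse (c d)"
      using ex_small_power[of "{d\<in>D. b' d < b d}" "\<lambda>d. c' d * inverse (c d)" \<alpha> "\<lambda>d. b d - b' d"]
        fin \<alpha> by auto
    have "c d * v ^ b d \<le> c' d * v ^ b' d" if d: "d \<in> D" for d
    proof (cases "b' d < b d")
      case True
      then have "c d * v ^ (b d - b' d) \<le> c d * (c' d * inverse (c d))"
        using v(2)[OF d] by simp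
      then show ?thesis
        using True by (simp add: mult_power_le_iff_sf mult.left_commute[of "c d"])
    next
      case False
      then show ?thesis
        using cc[OF d] v(1) by (intro mult_mono_sf power_increasing_sf) auto
    qed
    then have "R 1 v"
      by (simp add: R)
    then show False
      using one v(1) by auto
  qed
  then obtain d where d: "d \<in> D" "b' d < b d" "c d = c' d"
    by blast
  have "v \<le> u ^ a' d" if uv: "R u v" for u v
  proof -
    have u: "1 \<le> u" and v: "1 \<le> v"
      using bounds[OF uv] by auto
    have "(c' d * u ^ a d) * v ^ b d \<le> (c' d * u ^ a' d) * v ^ b' d"
      using uv d unfolding R by force
    then have *: "u ^ a d * v ^ (b d - b' d) \<le> u ^ a' d"
      using d(2) by (simp add: mult_power_le_iff_sf mult.assoc)
    have "1 * v ^ 1 \<le> u ^ a d * v ^ (b d - b' d)"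
      using u v d(2) by (intro mult_mono_sf one_le_power_sf power_increasing_sf) auto
    then show ?thesis
      using * by simp
  qed
  then show ?thesis
    by blast
next
  case False
  then have no: "\<nexists>v. R 1 v"
    using one by blast
  note elim = eliminate_variable[OF fin, of "\<lambda>d. c d * u ^ a d" b "\<lambda>d. c' d * u ^ a' d" b' for u, folded R]
  \<comment> \<open>The projection to the \<open>u\<close>-axis misses 1 because it violates one of the inequalities.\<close>
  have "\<exists>K K' s. K' < K \<and> (\<forall>u v. R u v \<longrightarrow> K \<le> K' * u ^ s)"
  proof -
    have *: "K \<le> K' * u ^ t" if "1 \<le> u" "K * u ^ s \<le> K' * u ^ t" for K K' u :: 'r and s t
    proof -
      have "K * 1 \<le> K * u ^ s"
        using one_le_power_sf[OF that(1)] by (simp only: mult_le_cancel_left_sf)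
      then show ?thesis
        using that(2) by simp
    qed
    from no[unfolded elim]
    consider d where "d \<in> D" "b d = b' d" "c' d < c d"
      | d e where "d \<in> D" "e \<in> D" "b' d < b d" "b e < b' e"
        "c' d ^ (b' e - b e) * c' e ^ (b d - b' d) < c d ^ (b' e - b e) * c e ^ (b d - b' d)"
      by (auto simp: not_le)
    then show ?thesis
    proof cases
      case 1
      have "c d \<le> c' d * u ^ a' d" if uv: "R u v" for u v
      proof -
        have "\<exists>v. R u v"
          using uv by blast
        then have "c d * u ^ a d \<le> c' d * u ^ a' d"
          using 1 unfolding elim by blast
        then show ?thesis
          using * bounds[OF uv] by blast
      qed
      then show ?thesis
        using 1 by blast
    next
      case 2
      define P Q where "P = b d - b' d" and "Q = b' e - b e"
      have "c d ^ Q * c e ^ P \<le> (c' d ^ Q * c' e ^ P) * u ^ (a' d * Q + a' e * P)" if uv: "R u v" for u v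
      proof -
        have "\<exists>v. R u v"
          using uv by blast
        then have "(c d * u ^ a d) ^ Q * (c e * u ^ a e) ^ P \<le> (c' d * u ^ a' d) ^ Q * (c' e * u ^ a' e) ^ P"
          using 2 unfolding elim P_def Q_def by blast
        then have "(c d ^ Q * c e ^ P) * u ^ (a d * Q + a e * P) \<le>
            (c' d ^ Q * c' e ^ P) * u ^ (a' d * Q + a' e * P)"
          by (simp add: power_mult_distrib power_add mult_ac flip: power_mult)
        then show ?thesis
          using * bounds[OF uv] by blast
      qed
      then show ?thesis
        using 2(5) unfolding P_def Q_def by blast
    qed
  qed
  then obtain K K' s where K: "K' < K" "\<And>u v. R u v \<Longrightarrow> K \<le> K' * u ^ s"
    by blast
  \<comment> \<open>The factor by which the violated inequality fails at \<open>u = 1\<close>.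
    Throughout the region \<open>u ^ s\<close> is at least \<open>\<delta>\<close>, so the
    archimedean property lets a power of it reach \<open>M\<close>.\<close>
  define \<delta> where "\<delta> = inverse K' * K"
  have "1 < \<delta>"
    using K(1) mult_less_cancel_right_sf[of 1 K' \<delta>] by (simp add: \<delta>_def mult.assoc mult.commute[of K K'])
  then obtain k where k: "M \<le> \<delta> ^ k"
    using archimedean_power by blast
  have "v \<le> u ^ (s * k)" if uv: "R u v" for u v
  proof -
    have "inverse K' * K \<le> inverse K' * (K' * u ^ s)"
      using K(2)[OF uv] by (simp only: mult_le_cancel_left_sf)
    then have "\<delta> ^ k \<le> (u ^ s) ^ k"
      by (intro power_mono_sf) (simp add: \<delta>_def)
    moreover have "v \<le> M"
      using bounds[OF uv] by blast
    ultimately show ?thesis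
      using k by (simp add: power_mult)
  qed
  then show ?thesis
    by blast
qed

text \<open>Makes room for two further coordinates: \<open>Inr False\<close> will hold the value
  \<open>u\<close> of the first quotient, \<open>Inr True\<close> the value \<open>v\<close> of the
  second.\<close>

definition monom_lift :: "('r::tropical_semifield, 'n) monomial \<Rightarrow> ('r, 'n + bool) monomial" where
  "monom_lift m = (fst m, case_sum (snd m) (\<lambda>_. 0))"

definition monom_var :: "'m \<Rightarrow> ('r::tropical_semifield, 'm) monomial" where
  "monom_var j = (1, \<lambda>i. if i = j then 1 else 0)"

lemma monom_val_sum:
  fixes m :: "('r::tropical_semifield, 'n::finite + bool) monomial"
  shows "monom_val m z = fst m * (\<Prod>i\<in>UNIV. (z $ Inl i) ^ snd m (Inl i)) *
    (z $ Inr False) ^ snd m (Inr False) * (z $ Inr True) ^ snd m (Inr True)"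
proof -
  have "(\<Prod>i\<in>UNIV. (z $ i) ^ snd m i) = (\<Prod>i\<in>UNIV <+> UNIV. (z $ i) ^ snd m i)"
    by simp
  also have "\<dots> = (\<Prod>i\<in>UNIV. (z $ Inl i) ^ snd m (Inl i)) * (\<Prod>b\<in>UNIV. (z $ Inr b) ^ snd m (Inr b))"
    by (subst prod.Plus) (simp_all add: comp_def)
  finally show ?thesis
    by (simp add: monom_val_def UNIV_bool mult.assoc)
qed

lemma monom_val_lift: "monom_val (monom_lift m) z = monom_val m (\<chi> i. z $ Inl i)"
  unfolding monom_val_sum by (simp add: monom_lift_def monom_val_def)

lemma monom_val_var: "monom_val (monom_var j) z = z $ j"
proof -
  have "(\<Prod>i\<in>UNIV. (z $ i) ^ (if i = j then 1 else 0)) = (\<Prod>i\<in>UNIV. if i = j then z $ i else 1)"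
    by (intro prod.cong) auto
  then show ?thesis
    by (simp add: monom_val_def monom_var_def)
qed

text \<open>The pairs of quotients \<open>u\<close> and \<open>v\<close> over the polyhedron of
  \<open>C\<close> are the projection of a polyhedron with two more coordinates. Eliminating the
  original variables describes them by inequalities in the plane, to which
  \<open>planar_bound\<close> applies.\<close>

lemma piece_bound:
  fixes C :: "(('r::tropical_semifield, 'n::finite) monomial \<times> ('r, 'n) monomial) set"
  assumes fin: "finite C"
    and le: "\<And>x. satisfies C x \<Longrightarrow> monom_val q x \<le> monom_val p x \<and> monom_val q' x \<le> monom_val p' x"
    and M: "\<And>x. satisfies C x \<Longrightarrow> monom_val p' x \<le> M * monom_val q' x"
    and one: "\<And>x. satisfies C x \<Longrightarrow> monom_val p x = monom_val q x \<Longrightarrow> monom_val p' x = monom_val q' x"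
    and \<alpha>: "(\<alpha>::'r) \<noteq> 1"
  shows "\<exists>k. \<forall>x u v. satisfies C x \<longrightarrow> u * monom_val q x = monom_val p x \<longrightarrow>
    v * monom_val q' x = monom_val p' x \<longrightarrow> v \<le> u ^ k"
proof -
  define R where "R u v \<longleftrightarrow> (\<exists>x. satisfies C x \<and> u * monom_val q x = monom_val p x \<and>
    v * monom_val q' x = monom_val p' x)" for u v
  define uq where "uq = monom_mult (monom_var (Inr False)) (monom_lift q)"
  define vq where "vq = monom_mult (monom_var (Inr True)) (monom_lift q')"
  \<comment> \<open>The two equations defining \<open>u\<close> and \<open>v\<close> enter as pairs
    of opposite inequalities.\<close>
  define E where "E = (\<lambda>c. (monom_lift (fst c), monom_lift (snd c))) ` C \<union>
    {(uq, monom_lift p), (monom_lift p, uq), (vq, monom_lift p'), (monom_lift p', vq)}"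
  have "finite E"
    using fin by (simp add: E_def)
  have E: "satisfies E y \<longleftrightarrow> satisfies C (\<chi> i. y $ Inl i) \<and>
      y $ Inr False * monom_val q (\<chi> i. y $ Inl i) = monom_val p (\<chi> i. y $ Inl i) \<and>
      y $ Inr True * monom_val q' (\<chi> i. y $ Inl i) = monom_val p' (\<chi> i. y $ Inl i)" for y
    unfolding satisfies_def E_def ball_Un order.eq_iff
    by (simp add: uq_def vq_def monom_val_mult monom_val_var monom_val_lift conj_assoc)
  obtain D where D: "finite D"
    "\<And>z. satisfies D z \<longleftrightarrow> (\<exists>y. (\<forall>i. i \<notin> range Inl \<longrightarrow> y $ i = z $ i) \<and> satisfies E y)"
    using eliminate_variables[OF \<open>finite E\<close>, of "range Inl"] by blast
  \<comment> \<open>\<open>D\<close> constrains only the coordinates \<open>Inr False\<close> and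
    \<open>Inr True\<close>; the placeholder 1 at the others makes their powers vanish from the
    monomials of \<open>D\<close>.\<close>
  define z :: "'r \<Rightarrow> 'r \<Rightarrow> 'r ^ ('n + bool)"
    where "z u v = (\<chi> i. case i of Inl _ \<Rightarrow> 1 | Inr b \<Rightarrow> if b then v else u)" for u v
  have z: "z u v $ Inl i = 1" "z u v $ Inr False = u" "z u v $ Inr True = v" for u v i
    by (simp_all add: z_def)
  have R1: "R u v \<longleftrightarrow> satisfies D (z u v)" for u v
  proof
    assume "R u v"
    then obtain x where x: "satisfies C x" "u * monom_val q x = monom_val p x"
      "v * monom_val q' x = monom_val p' x"
      by (auto simp: R_def)
    define y :: "'r ^ ('n + bool)" where "y = (\<chi> i. case i of Inl i \<Rightarrow> x $ i | Inr b \<Rightarrow> if b then v else u)"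
    have "(\<chi> i. y $ Inl i) = x"
      by (simp add: y_def vec_eq_iff)
    then have "satisfies E y"
      using x by (simp add: E y_def)
    moreover have "y $ i = z u v $ i" if "i \<notin> range Inl" for i
      using that by (cases i) (auto simp: y_def z_def)
    ultimately show "satisfies D (z u v)"
      unfolding D(2) by blast
  next
    assume "satisfies D (z u v)"
    then obtain y where y: "\<And>i. i \<notin> range Inl \<Longrightarrow> y $ i = z u v $ i" "satisfies E y"
      unfolding D(2) by blast
    have "y $ Inr False = u" "y $ Inr True = v"
      using y(1)[of "Inr False"] y(1)[of "Inr True"] by (auto simp: z)
    then show "R u v"
      using y(2) unfolding E R_def by blast
  qed
  have "R u v \<longleftrightarrow> (\<forall>d\<in>D. (fst (fst d) * u ^ snd (fst d) (Inr False)) * v ^ snd (fst d) (Inr True) \<le>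
      (fst (snd d) * u ^ snd (snd d) (Inr False)) * v ^ snd (snd d) (Inr True))" for u v
    unfolding R1 satisfies_def monom_val_sum z by simp
  moreover have "1 \<le> u \<and> 1 \<le> v \<and> v \<le> M" if "R u v" for u v
  proof -
    obtain x where x: "satisfies C x" "u * monom_val q x = monom_val p x"
      "v * monom_val q' x = monom_val p' x"
      using \<open>R u v\<close> by (auto simp: R_def)
    have "1 * monom_val q x \<le> u * monom_val q x" "1 * monom_val q' x \<le> v * monom_val q' x"
      "v * monom_val q' x \<le> M * monom_val q' x"
      using le[OF x(1)] M[OF x(1)] unfolding x(2,3) by auto
    then show ?thesis
      unfolding mult_le_cancel_right_sf by blast
  qed
  moreover have "v = 1" if "R 1 v" for v
  proof -
    obtain x where x: "satisfies C x" "monom_val p x = monom_val q x" "v * monom_val q' x = monom_val p' x"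
      using \<open>R 1 v\<close> by (auto simp: R_def)
    have "v * monom_val q' x = 1 * monom_val q' x"
      using one[OF x(1,2)] x(3) by simp
    then show ?thesis
      unfolding mult_right_cancel_sf .
  qed
  ultimately have "\<exists>k. \<forall>u v. R u v \<longrightarrow> v \<le> u ^ k"
    by (rule planar_bound[OF D(1) _ _ _ \<alpha>])
  then show ?thesis
    unfolding R_def by blast
qed

section \<open>Polynomial values and the semifield of rational functions\<close>

lemma poly_val_ge: "polynomial H \<Longrightarrow> m \<in> H \<Longrightarrow> monom_val m x \<le> poly_val H x"
  by (simp add: poly_val_def polynomial_def)

lemma poly_val_attained:
  assumes "polynomial H"
  obtains m where "m \<in> H" "monom_val m x = poly_val H x"
proof -
  have "poly_val H x \<in> (\<lambda>m. monom_val m x) ` H"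
    unfolding poly_val_def using assms by (intro Max_in) (auto simp: polynomial_def)
  then show ?thesis
    using that by (elim imageE) simp
qed

lemma poly_val_le_iff: "polynomial H \<Longrightarrow> poly_val H x \<le> t \<longleftrightarrow> (\<forall>m\<in>H. monom_val m x \<le> t)"
  by (simp add: poly_val_def polynomial_def)

lemma polynomial_Un: "polynomial H \<Longrightarrow> polynomial G \<Longrightarrow> polynomial (H \<union> G)"
  by (simp add: polynomial_def)

lemma poly_val_Un:
  assumes "polynomial H" "polynomial G"
  shows "poly_val (H \<union> G) x = poly_val H x + poly_val G x"
  using assms by (simp add: poly_val_def polynomial_def image_Un Max_Un add_eq_max)

definition poly_mult :: "('r::tropical_semifield, 'n) monomial set \<Rightarrow> ('r, 'n) monomial set \<Rightarrow> ('r, 'n) monomial set" where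
  "poly_mult H G = (\<Union>h\<in>H. monom_mult h ` G)"

lemma polynomial_mult: "polynomial H \<Longrightarrow> polynomial G \<Longrightarrow> polynomial (poly_mult H G)"
  by (auto simp: polynomial_def poly_mult_def)

lemma monom_mult_in: "h \<in> H \<Longrightarrow> g \<in> G \<Longrightarrow> monom_mult h g \<in> poly_mult H G"
  by (auto simp: poly_mult_def)

lemma poly_val_mult:
  assumes "polynomial H" "polynomial G"
  shows "poly_val (poly_mult H G) x = poly_val H x * poly_val G x"
proof (rule order_antisym)
  show "poly_val (poly_mult H G) x \<le> poly_val H x * poly_val G x"
    unfolding poly_val_le_iff[OF polynomial_mult[OF assms]]
    using assms by (auto simp: poly_mult_def monom_val_mult intro!: mult_mono_sf poly_val_ge)
  obtain h g where "h \<in> H" "monom_val h x = poly_val H x" "g \<in> G" "monom_val g x = poly_val G x"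
    using poly_val_attained assms by metis
  then show "poly_val H x * poly_val G x \<le> poly_val (poly_mult H G) x"
    by (metis assms monom_mult_in monom_val_mult poly_val_ge polynomial_mult)
qed

lemma rational_functions_iff:
  "f \<in> rational_functions \<longleftrightarrow>
    (\<exists>H G. polynomial H \<and> polynomial G \<and> (\<forall>x. f x * poly_val G x = poly_val H x))"
proof -
  have "f = poly_val H / poly_val G \<longleftrightarrow> (\<forall>x. f x * poly_val G x = poly_val H x)" for H G
    using divide_eq_iff_sf[of "poly_val H _" "poly_val G _"]
    by (simp add: fun_eq_iff divide_fun_def eq_commute[of "f _"]) (simp add: eq_commute)
  then show ?thesis
    by (auto simp: rational_functions_def)
qed

lemma const_rational: "(\<lambda>_. c) \<in> rational_functions"
proof -
  have "polynomial {(c, \<lambda>_. 0)}" "polynomial {(1, \<lambda>_. 0)}" for c :: 'a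
    by (simp_all add: polynomial_def)
  moreover have "c * poly_val {(1, \<lambda>_. 0)} x = poly_val {(c, \<lambda>_. 0)} x" for x :: "'a ^ 'b"
    by (simp add: poly_val_def monom_val_def)
  ultimately show ?thesis
    unfolding rational_functions_iff by blast
qed

lemma subsemifield_rational: "subsemifield rational_functions"
  unfolding subsemifield_def
proof (intro conjI ballI)
  show "1 \<in> rational_functions"
    using const_rational[of 1] by (simp add: one_fun_def)
  fix f :: "'a ^ 'b \<Rightarrow> 'a" assume "f \<in> rational_functions"
  then obtain H G where f: "polynomial H" "polynomial G" "\<And>x. f x * poly_val G x = poly_val H x"
    unfolding rational_functions_iff by blast
  have "inverse f x * poly_val H x = poly_val G x" for x
    by (simp add: inverse_fun_apply flip: f(3))
  then show "inverse f \<in> rational_functions"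
    using f(1,2) unfolding rational_functions_iff by blast
  fix g :: "'a ^ 'b \<Rightarrow> 'a" assume "g \<in> rational_functions"
  then obtain H' G' where g: "polynomial H'" "polynomial G'" "\<And>x. g x * poly_val G' x = poly_val H' x"
    unfolding rational_functions_iff by blast
  have "(f * g) x * poly_val (poly_mult G G') x = poly_val (poly_mult H H') x" for x
    using f(1,2) g(1,2) by (simp add: poly_val_mult mult_ac flip: f(3) g(3))
  then show "f * g \<in> rational_functions"
    using f(1,2) g(1,2) polynomial_mult unfolding rational_functions_iff by blast
  have "(f + g) x * poly_val (poly_mult G G') x = poly_val (poly_mult H G' \<union> poly_mult G H') x" for x
    using f(1,2) g(1,2) by (simp add: poly_val_mult poly_val_Un polynomial_mult distrib_left distrib_right mult_ac flip: f(3) g(3))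
  moreover have "polynomial (poly_mult G G')" "polynomial (poly_mult H G' \<union> poly_mult G H')"
    using f(1,2) g(1,2) by (simp_all add: polynomial_mult polynomial_Un)
  ultimately show "f + g \<in> rational_functions"
    unfolding rational_functions_iff by blast
qed

text \<open>The space is covered by finitely many pieces, one for each choice of dominant terms in
  fractions representing \<open>av f\<close> and \<open>av g\<close>. On a piece both are quotients
  of monomials and \<open>piece_bound\<close> yields an exponent; the largest of these serves
  everywhere, as \<open>av f\<close> is at least 1.\<close>

theorem bounded_power_bound:
  fixes f g :: "'r::tropical_semifield ^ 'n::finite \<Rightarrow> 'r"
  assumes f: "f \<in> rational_functions" and g: "g \<in> rational_functions"
    and M: "\<And>x. av (g x) \<le> M"
    and sub: "{x. f x = 1} \<subseteq> {x. g x = 1}"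
    and \<alpha>: "(\<alpha>::'r) \<noteq> 1"
  shows "\<exists>k. \<forall>x. av (g x) \<le> av (f x) ^ k"
proof -
  note S = subsemifieldD[OF subsemifield_rational]
  have av: "(h + inverse h) x = av (h x)" for h :: "'r ^ 'n \<Rightarrow> 'r" and x
    by (simp add: av_def inverse_fun_apply)
  have "f + inverse f \<in> rational_functions" "g + inverse g \<in> rational_functions"
    using f g by (auto intro: S)
  then obtain P Q P' Q' where poly: "polynomial P" "polynomial Q" "polynomial P'" "polynomial Q'"
    and PQ: "\<And>x. av (f x) * poly_val Q x = poly_val P x" "\<And>x. av (g x) * poly_val Q' x = poly_val P' x"
    unfolding rational_functions_iff av by blast
  have "\<exists>k. \<forall>x. monom_val p x = poly_val P x \<longrightarrow> monom_val q x = poly_val Q x \<longrightarrow>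
      monom_val p' x = poly_val P' x \<longrightarrow> monom_val q' x = poly_val Q' x \<longrightarrow> av (g x) \<le> av (f x) ^ k"
    if mem: "p \<in> P" "q \<in> Q" "p' \<in> P'" "q' \<in> Q'" for p q p' q'
  proof -
    \<comment> \<open>The polyhedron of the piece: each chosen term dominates its
      polynomial.\<close>
    define C where "C = (\<lambda>m. (m, p)) ` P \<union> (\<lambda>m. (m, q)) ` Q \<union> (\<lambda>m. (m, p')) ` P' \<union> (\<lambda>m. (m, q')) ` Q'"
    have "finite C"
      using poly by (simp add: C_def polynomial_def)
    have C: "satisfies C x \<longleftrightarrow> poly_val P x \<le> monom_val p x \<and> poly_val Q x \<le> monom_val q x \<and>
        poly_val P' x \<le> monom_val p' x \<and> poly_val Q' x \<le> monom_val q' x" for x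
      unfolding satisfies_def C_def ball_Un poly_val_le_iff[OF poly(1)] poly_val_le_iff[OF poly(2)]
        poly_val_le_iff[OF poly(3)] poly_val_le_iff[OF poly(4)]
      by simp
    have eq: "monom_val p x = av (f x) * monom_val q x" "monom_val p' x = av (g x) * monom_val q' x"
      if "satisfies C x" for x
    proof -
      have "monom_val p x = poly_val P x" "monom_val q x = poly_val Q x"
        "monom_val p' x = poly_val P' x" "monom_val q' x = poly_val Q' x"
        using that[unfolded C] mem poly by (simp_all add: order.antisym poly_val_ge)
      then show "monom_val p x = av (f x) * monom_val q x" "monom_val p' x = av (g x) * monom_val q' x"
        using PQ by simp_all
    qed
    have one: "1 * t \<le> av a * t" for t a :: 'r
      unfolding mult_le_cancel_right_sf by (rule one_le_av)
    have "\<exists>k. \<forall>x u v. satisfies C x \<longrightarrow> u * monom_val q x = monom_val p x \<longrightarrow>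
        v * monom_val q' x = monom_val p' x \<longrightarrow> v \<le> u ^ k"
    proof (rule piece_bound[OF \<open>finite C\<close> _ _ _ \<alpha>])
      fix x assume x: "satisfies C x"
      show "monom_val q x \<le> monom_val p x \<and> monom_val q' x \<le> monom_val p' x"
        using one[of "monom_val q x" "f x"] one[of "monom_val q' x" "g x"] unfolding eq[OF x] by simp
      show "monom_val p' x \<le> M * monom_val q' x"
        unfolding eq[OF x] mult_le_cancel_right_sf by (rule M)
      assume "monom_val p x = monom_val q x"
      then have "av (f x) * monom_val q x = 1 * monom_val q x"
        unfolding eq[OF x] by simp
      then have "f x = 1"
        unfolding mult_right_cancel_sf by simp
      then have "g x = 1"
        using sub by blast
      then show "monom_val p' x = monom_val q' x"
        unfolding eq[OF x] by simp
    qed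
    then obtain k where k: "\<And>x u v. satisfies C x \<Longrightarrow> u * monom_val q x = monom_val p x \<Longrightarrow>
        v * monom_val q' x = monom_val p' x \<Longrightarrow> v \<le> u ^ k"
      by blast
    have "av (g x) \<le> av (f x) ^ k"
      if "monom_val p x = poly_val P x" "monom_val q x = poly_val Q x"
        "monom_val p' x = poly_val P' x" "monom_val q' x = poly_val Q' x" for x
      by (rule k[of x]) (simp_all add: C that PQ)
    then show ?thesis
      by blast
  qed
  then obtain k where k: "\<And>p q p' q' x. p \<in> P \<Longrightarrow> q \<in> Q \<Longrightarrow> p' \<in> P' \<Longrightarrow> q' \<in> Q' \<Longrightarrow>
      monom_val p x = poly_val P x \<Longrightarrow> monom_val q x = poly_val Q x \<Longrightarrow>
      monom_val p' x = poly_val P' x \<Longrightarrow> monom_val q' x = poly_val Q' x \<Longrightarrow>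
      av (g x) \<le> av (f x) ^ k p q p' q'"
    by metis
  define K where "K = Max ((\<lambda>(p, q, p', q'). k p q p' q') ` (P \<times> Q \<times> P' \<times> Q'))"
  have "av (g x) \<le> av (f x) ^ K" for x
  proof -
    obtain p where p: "p \<in> P" "monom_val p x = poly_val P x"
      using poly_val_attained[OF poly(1)] .
    obtain q where q: "q \<in> Q" "monom_val q x = poly_val Q x"
      using poly_val_attained[OF poly(2)] .
    obtain p' where p': "p' \<in> P'" "monom_val p' x = poly_val P' x"
      using poly_val_attained[OF poly(3)] .
    obtain q' where q': "q' \<in> Q'" "monom_val q' x = poly_val Q' x"
      using poly_val_attained[OF poly(4)] .
    have "(p, q, p', q') \<in> P \<times> Q \<times> P' \<times> Q'" "finite (P \<times> Q \<times> P' \<times> Q')"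
      using p q p' q' poly by (simp_all add: polynomial_def)
    then have "k p q p' q' \<le> K"
      unfolding K_def by (intro Max_ge finite_imageI) force+
    then have "av (f x) ^ k p q p' q' \<le> av (f x) ^ K"
      by (intro power_increasing_sf one_le_av)
    then show ?thesis
      using k[OF p(1) q(1) p'(1) q'(1) p(2) q(2) p'(2) q'(2)] by (rule order_trans[rotated])
  qed
  then show ?thesis
    by blast
qed

section \<open>Corner loci as skeletons\<close>

text \<open>A point fails to be a corner root exactly if a single term of multiplicity one strictly
  dominates all others. The existential definition thus becomes a conjunction over such terms, each
  compared with the remaining ones.\<close>

lemma corner_root_iff:
  assumes f: "supertropical f"
  shows "corner_root f a \<longleftrightarrow>
    (\<forall>m. count f m = 1 \<longrightarrow> (\<exists>m'\<in>#f. m' \<noteq> m \<and> monom_val m a \<le> monom_val m' a))"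
proof
  have pol: "polynomial (set_mset f)"
    using f by (simp add: supertropical_def polynomial_def)
  have le: "monom_val m a \<le> poly_val (set_mset f) a" if "m \<in># f" for m
    using poly_val_ge[OF pol that] .
  show "\<forall>m. count f m = 1 \<longrightarrow> (\<exists>m'\<in>#f. m' \<noteq> m \<and> monom_val m a \<le> monom_val m' a)" if "corner_root f a"
  proof (intro allI impI)
    fix m assume m: "count f m = 1"
    then have mf: "m \<in># f"
      by (simp flip: count_greater_zero_iff)
    from that consider m1 m2 where "m1 \<in># f" "m2 \<in># f" "m1 \<noteq> m2"
        "monom_val m1 a = poly_val (set_mset f) a" "monom_val m2 a = poly_val (set_mset f) a"
      | m1 where "count f m1 = 2" "monom_val m1 a = poly_val (set_mset f) a"
      unfolding corner_root_def by blast
    then show "\<exists>m'\<in>#f. m' \<noteq> m \<and> monom_val m a \<le> monom_val m' a"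
    proof cases
      case 1
      then show ?thesis
        using le[OF mf] by metis
    next
      case 2
      then have "m1 \<in># f" "m1 \<noteq> m"
        using m by (auto simp flip: count_greater_zero_iff)
      then show ?thesis
        using le[OF mf] 2 by metis
    qed
  qed
  show "corner_root f a"
    if *: "\<forall>m. count f m = 1 \<longrightarrow> (\<exists>m'\<in>#f. m' \<noteq> m \<and> monom_val m a \<le> monom_val m' a)"
  proof -
    obtain m where m: "m \<in># f" "monom_val m a = poly_val (set_mset f) a"
      using poly_val_attained[OF pol] .
    have "count f m \<le> 2" "0 < count f m"
      using f m(1) unfolding supertropical_def by (blast, simp)
    then consider "count f m = 1" | "count f m = 2"
      by linarith
    then show ?thesis
    proof cases
      case 1
      then obtain m' where "m' \<in># f" "m' \<noteq> m" "monom_val m a \<le> monom_val m' a"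
        using * by blast
      then have "monom_val m' a = poly_val (set_mset f) a"
        using le[of m'] m(2) by simp
      then show ?thesis
        using m \<open>m' \<in># f\<close> \<open>m' \<noteq> m\<close> unfolding corner_root_def by blast
    next
      case 2
      then show ?thesis
        using m unfolding corner_root_def by blast
    qed
  qed
qed

text \<open>The term \<open>h\<close> plus the ghost of \<open>G\<close>; a term \<open>h\<close> that occurs in \<open>G\<close> is absorbed by the
  ghost, since a multiplicity above 2 is not allowed.\<close>

definition below_poly :: "('r, 'n) monomial \<Rightarrow> ('r, 'n) monomial set \<Rightarrow> ('r, 'n) monomial multiset" where
  "below_poly h G = (if h \<in> G then {#} else {#h#}) + mset_set G + mset_set G"

lemma count_below_poly:
  "finite G \<Longrightarrow> count (below_poly h G) m = (if m \<in> G then 2 else if m = h then 1 else 0)"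
  by (auto simp: below_poly_def count_mset_set')

lemma supertropical_below_poly:
  assumes "polynomial G"
  shows "supertropical (below_poly h G)"
proof -
  obtain g where G: "finite G" "g \<in> G"
    using assms unfolding polynomial_def by blast
  have "count (below_poly h G) g \<noteq> count {#} g"
    using G by (simp add: count_below_poly)
  moreover have "count (below_poly h G) m \<le> 2" for m
    using G by (simp add: count_below_poly)
  ultimately show ?thesis
    unfolding supertropical_def by metis
qed

text \<open>Only \<open>h\<close> can have multiplicity one, so \<open>corner_root_iff\<close>
  leaves a single condition. If \<open>h\<close> lies in \<open>G\<close>, no condition is left and
  the inequality holds automatically.\<close>

lemma corner_root_below_poly:
  assumes G: "polynomial G"
  shows "corner_root (below_poly h G) a \<longleftrightarrow> monom_val h a \<le> poly_val G a"
proof -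
  have fin: "finite G"
    using G by (simp add: polynomial_def)
  have set: "set_mset (below_poly h G) = insert h G"
    using fin by (auto simp: below_poly_def)
  have "corner_root (below_poly h G) a \<longleftrightarrow> (h \<notin> G \<longrightarrow> (\<exists>g\<in>G. monom_val h a \<le> monom_val g a))"
  proof -
    have "count (below_poly h G) m = 1 \<longleftrightarrow> m = h \<and> h \<notin> G" for m
      by (simp add: count_below_poly[OF fin])
    then have "corner_root (below_poly h G) a \<longleftrightarrow>
        (h \<notin> G \<longrightarrow> (\<exists>m'\<in>insert h G. m' \<noteq> h \<and> monom_val h a \<le> monom_val m' a))"
      unfolding corner_root_iff[OF supertropical_below_poly[OF G]] set by (simp only:) blast
    moreover have "(\<exists>m'\<in>insert h G. m' \<noteq> h \<and> monom_val h a \<le> monom_val m' a) \<longleftrightarrow>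
        (\<exists>g\<in>G. monom_val h a \<le> monom_val g a)" if "h \<notin> G"
    proof -
      have "g \<noteq> h" if "g \<in> G" for g
        using that \<open>h \<notin> G\<close> by auto
      then show ?thesis
        by (simp cong: bex_cong)
    qed
    ultimately show ?thesis
      by blast
  qed
  also have "\<dots> \<longleftrightarrow> monom_val h a \<le> poly_val G a"
    using poly_val_ge[OF G] poly_val_attained[OF G, of a] by (metis order_trans)
  finally show ?thesis .
qed

lemma one_set_corner_loci:
  assumes "f \<in> rational_functions"
  shows "{x. f x = 1} \<in> corner_loci"
proof -
  obtain H G where HG: "polynomial H" "polynomial G" "\<And>x. f x * poly_val G x = poly_val H x"
    using assms unfolding rational_functions_iff by blast
  define F where "F = (\<lambda>h. below_poly h G) ` H \<union> (\<lambda>g. below_poly g H) ` G"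
  have "f x = 1 \<longleftrightarrow> f x * poly_val G x = 1 * poly_val G x" for x
    by (simp only: mult_right_cancel_sf)
  then have "f x = 1 \<longleftrightarrow> poly_val H x \<le> poly_val G x \<and> poly_val G x \<le> poly_val H x" for x
    unfolding HG(3) mult_1_left by (simp only: order.eq_iff)
  moreover have "x \<in> Cor F \<longleftrightarrow> poly_val H x \<le> poly_val G x \<and> poly_val G x \<le> poly_val H x" for x
    unfolding Cor_def F_def ball_Un mem_Collect_eq poly_val_le_iff[OF HG(1)] poly_val_le_iff[OF HG(2)]
    using HG(1,2) by (simp add: corner_root_below_poly)
  ultimately have "{x. f x = 1} = Cor F"
    by blast
  moreover have "finite F" "F \<noteq> {}" "\<forall>p\<in>F. supertropical p"
    using HG(1,2) by (auto simp: F_def polynomial_def intro!: supertropical_below_poly)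
  ultimately show ?thesis
    unfolding corner_loci_def by blast
qed

text \<open>By \<open>kernel_hull_eq\<close> and \<open>Skel_dominated\<close> these are the
  skeletons of the principal kernels of all rational functions, bounded or not.\<close>

definition one_sets :: "('r::tropical_semifield ^ 'n::finite) set set" where
  "one_sets = (\<lambda>f. {x. f x = 1}) ` rational_functions"

lemma one_sets_Int:
  assumes "A \<in> one_sets" "B \<in> one_sets"
  shows "A \<inter> B \<in> one_sets"
proof -
  obtain f g where "f \<in> rational_functions" "g \<in> rational_functions" "A = {x. f x = 1}" "B = {x. g x = 1}"
    using assms by (auto simp: one_sets_def)
  then show ?thesis
    using dominated_times[OF subsemifield_rational, of f g] unfolding one_sets_def by blast
qed

lemma UNIV_one_sets: "UNIV \<in> one_sets"
  using const_rational[of 1] unfolding one_sets_def by force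

lemma one_sets_INT:
  assumes "finite I" "\<And>i. i \<in> I \<Longrightarrow> A i \<in> one_sets"
  shows "(\<Inter>i\<in>I. A i) \<in> one_sets"
  using assms by (induction I rule: finite_induct) (simp_all add: UNIV_one_sets one_sets_Int)

text \<open>Let \<open>U\<close> consist of the terms other than \<open>m\<close>. Adding
  \<open>m\<close> leaves the value of \<open>U\<close> unchanged exactly where another term is at
  least \<open>m\<close>, so this condition on \<open>m\<close> says that the fraction of
  \<open>T\<close> by \<open>U\<close> is 1.\<close>

lemma corner_locus_one_sets:
  fixes p :: "('r::tropical_semifield, 'n::finite) monomial multiset"
  assumes p: "supertropical p" and \<alpha>: "(\<alpha>::'r) \<noteq> 1"
  shows "{a. corner_root p a} \<in> one_sets"
proof -
  define T where "T = set_mset p"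
  have T: "polynomial T"
    using p by (simp add: T_def supertropical_def polynomial_def)
  have *: "{a. \<exists>m'\<in>T. m' \<noteq> m \<and> monom_val m a \<le> monom_val m' a} \<in> one_sets" if m: "m \<in> T" for m
  proof (cases "T - {m} = {}")
    case True
    \<comment> \<open>A lone term is never matched, so the set is empty, like the set where the
      constant \<open>\<alpha>\<close> equals 1.\<close>
    then have "{a. \<exists>m'\<in>T. m' \<noteq> m \<and> monom_val m a \<le> monom_val m' a} = {a. (\<lambda>_. \<alpha>) a = 1}"
      using \<alpha> by auto
    then show ?thesis
      using const_rational[of \<alpha>] unfolding one_sets_def by (rule image_eqI)
  next
    case False
    define U where "U = T - {m}"
    have U: "polynomial U"
      using False T by (simp add: U_def polynomial_def)
    define f where "f = poly_val T / poly_val U"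
    have "f a = 1 \<longleftrightarrow> (\<exists>m'\<in>T. m' \<noteq> m \<and> monom_val m a \<le> monom_val m' a)" for a
    proof -
      have "T = {m} \<union> U"
        using m by (auto simp: U_def)
      then have "poly_val T a = monom_val m a + poly_val U a"
        using poly_val_Un[of "{m}" U a] U by (simp add: polynomial_def poly_val_def)
      then have "f a = 1 \<longleftrightarrow> monom_val m a \<le> poly_val U a"
        by (simp add: f_def divide_fun_def divide_eq_iff_sf less_eq_iff_add)
      also have "\<dots> \<longleftrightarrow> (\<exists>m'\<in>U. monom_val m a \<le> monom_val m' a)"
        using poly_val_ge[OF U] poly_val_attained[OF U, of a] by (metis order_trans)
      finally show ?thesis
        by (auto simp: U_def)
    qed
    moreover have "f \<in> rational_functions"
      using T U by (auto simp: rational_functions_def f_def)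
    ultimately show ?thesis
      unfolding one_sets_def by (intro image_eqI[of _ _ f]) auto
  qed
  \<comment> \<open>If all terms are ghosts, the index set is empty and the intersection is the
    whole space.\<close>
  have "{a. corner_root p a} = (\<Inter>m\<in>{m\<in>T. count p m = 1}. {a. \<exists>m'\<in>T. m' \<noteq> m \<and> monom_val m a \<le> monom_val m' a})"
  proof -
    have "m \<in> T" if "count p m = 1" for m
      using that by (simp add: T_def flip: count_greater_zero_iff)
    then show ?thesis
      unfolding corner_root_iff[OF p] T_def[symmetric] by blast
  qed
  also have "\<dots> \<in> one_sets"
    by (rule one_sets_INT) (use T * in \<open>auto simp: polynomial_def\<close>)
  finally show ?thesis .
qed

lemma corner_loci_eq_one_sets:
  assumes \<alpha>: "(\<alpha>::'r::tropical_semifield) \<noteq> 1"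
  shows "(corner_loci :: ('r ^ 'n::finite) set set) = one_sets"
proof (intro equalityI subsetI)
  fix L :: "('r ^ 'n) set"
  show "L \<in> corner_loci" if "L \<in> one_sets"
    using that one_set_corner_loci unfolding one_sets_def by blast
  assume "L \<in> corner_loci"
  then obtain F where F: "finite F" "\<And>p. p \<in> F \<Longrightarrow> supertropical p" "L = Cor F"
    unfolding corner_loci_def by blast
  have "Cor F = (\<Inter>p\<in>F. {a. corner_root p a})"
    by (auto simp: Cor_def)
  then show "L \<in> one_sets"
    unfolding F(3) by (simp only:) (rule one_sets_INT[OF F(1)], rule corner_locus_one_sets[OF F(2) \<alpha>])
qed

section \<open>Regular corner loci\<close>

text \<open>A tangible polynomial has no repetitions, so its corner roots depend only on its set of
  terms and the ghost alternative disappears.\<close>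

definition tangible_locus :: "('r::tropical_semifield, 'n::finite) monomial set \<Rightarrow> ('r ^ 'n) set" where
  "tangible_locus T = {a. \<exists>m\<in>T. \<exists>m'\<in>T. m \<noteq> m' \<and>
     monom_val m a = poly_val T a \<and> monom_val m' a = poly_val T a}"

lemma corner_root_tangible:
  assumes "tangible p"
  shows "corner_root p a \<longleftrightarrow> a \<in> tangible_locus (set_mset p)"
proof -
  have "count p m \<noteq> 2" for m
    using assms[unfolded tangible_def, rule_format, of m] by simp
  then show ?thesis
    by (simp add: corner_root_def tangible_locus_def)
qed

lemma regular_corner_loci_eq:
  "regular_corner_loci = {\<Inter>(tangible_locus ` \<T>) |\<T>. finite \<T> \<and> \<T> \<noteq> {} \<and> (\<forall>T\<in>\<T>. polynomial T)}"
proof (intro equalityI subsetI)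
  fix L :: "('a ^ 'b) set"
  assume "L \<in> regular_corner_loci"
  then obtain F where F: "finite F" "F \<noteq> {}" "\<And>p. p \<in> F \<Longrightarrow> supertropical p" "\<And>p. p \<in> F \<Longrightarrow> tangible p" "L = Cor F"
    unfolding regular_corner_loci_def by blast
  have "L = \<Inter>(tangible_locus ` set_mset ` F)"
    using F(4,5) by (auto simp: Cor_def corner_root_tangible)
  moreover have "\<forall>T\<in>set_mset ` F. polynomial T"
    using F(3) by (auto simp: supertropical_def polynomial_def)
  ultimately show "L \<in> {\<Inter>(tangible_locus ` \<T>) |\<T>. finite \<T> \<and> \<T> \<noteq> {} \<and> (\<forall>T\<in>\<T>. polynomial T)}"
    using F(1,2) by (intro CollectI exI[of _ "set_mset ` F"]) simp
next
  fix L :: "('a ^ 'b) set"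
  assume "L \<in> {\<Inter>(tangible_locus ` \<T>) |\<T>. finite \<T> \<and> \<T> \<noteq> {} \<and> (\<forall>T\<in>\<T>. polynomial T)}"
  then obtain \<T> where T: "finite \<T>" "\<T> \<noteq> {}" "\<And>T. T \<in> \<T> \<Longrightarrow> polynomial T" "L = \<Inter>(tangible_locus ` \<T>)"
    by blast
  have tan: "tangible (mset_set T)" for T :: "('a, 'b) monomial set"
    by (simp add: tangible_def count_mset_set')
  have "supertropical (mset_set T)" if "T \<in> \<T>" for T
    using T(3)[OF that] by (auto simp: supertropical_def polynomial_def mset_set_empty_iff count_mset_set')
  moreover have "L = Cor (mset_set ` \<T>)"
    using T(3,4) by (auto simp: Cor_def corner_root_tangible[OF tan] polynomial_def)
  ultimately show "L \<in> regular_corner_loci"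
    using T(1,2) tan unfolding regular_corner_loci_def by (intro CollectI exI[of _ "mset_set ` \<T>"]) auto
qed

text \<open>By strict monotonicity a product of terms is dominant exactly if both factors are. Since
  monomials cancel, two dominant terms of one polynomial stay distinct after multiplication by a
  dominant term of the other; conversely, different products differ in at least one factor.\<close>

lemma tangible_locus_mult:
  assumes T: "polynomial T" and U: "polynomial U"
  shows "tangible_locus (poly_mult T U) = tangible_locus T \<union> tangible_locus U"
proof -
  have cancel: "monom_mult s u = monom_mult t u \<Longrightarrow> s = t" "monom_mult u s = monom_mult u t \<Longrightarrow> s = t"
    for s t u :: "('a, 'b) monomial"
    by (auto simp: monom_mult_def fun_eq_iff prod_eq_iff)
  have val: "monom_val s a = poly_val T a \<and> monom_val u a = poly_val U a \<longleftrightarrow>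
      monom_val (monom_mult s u) a = poly_val (poly_mult T U) a" if su: "s \<in> T" "u \<in> U" for s u a
  proof
    assume *: "monom_val (monom_mult s u) a = poly_val (poly_mult T U) a"
    have le: "monom_val s a \<le> poly_val T a" "monom_val u a \<le> poly_val U a"
      by (rule poly_val_ge[OF T su(1)] poly_val_ge[OF U su(2)])+
    have "\<not> monom_val s a < poly_val T a"
      using mult_strict_mono_sf[OF _ le(2), of "monom_val s a" "poly_val T a"] *
      by (auto simp: poly_val_mult[OF T U] monom_val_mult)
    moreover have "\<not> monom_val u a < poly_val U a"
      using mult_strict_mono_sf[OF _ le(1), of "monom_val u a" "poly_val U a"] *
      by (auto simp: poly_val_mult[OF T U] monom_val_mult mult.commute)
    ultimately show "monom_val s a = poly_val T a \<and> monom_val u a = poly_val U a"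
      using le by auto
  qed (simp add: poly_val_mult[OF T U] monom_val_mult)
  show ?thesis
  proof (intro equalityI subsetI)
    fix a assume "a \<in> tangible_locus (poly_mult T U)"
    then obtain s u s' u' where su: "s \<in> T" "u \<in> U" "s' \<in> T" "u' \<in> U" "monom_mult s u \<noteq> monom_mult s' u'"
      "monom_val (monom_mult s u) a = poly_val (poly_mult T U) a"
      "monom_val (monom_mult s' u') a = poly_val (poly_mult T U) a"
      unfolding tangible_locus_def poly_mult_def by blast
    then have "s \<noteq> s' \<or> u \<noteq> u'"
      by blast
    then show "a \<in> tangible_locus T \<union> tangible_locus U"
      using su(1-4) val[OF su(1,2), of a] val[OF su(3,4), of a] su(6,7) unfolding tangible_locus_def by blast
  next
    fix a assume "a \<in> tangible_locus T \<union> tangible_locus U"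
    then consider s s' where "s \<in> T" "s' \<in> T" "s \<noteq> s'" "monom_val s a = poly_val T a" "monom_val s' a = poly_val T a"
      | u u' where "u \<in> U" "u' \<in> U" "u \<noteq> u'" "monom_val u a = poly_val U a" "monom_val u' a = poly_val U a"
      unfolding tangible_locus_def by blast
    then show "a \<in> tangible_locus (poly_mult T U)"
    proof cases
      case 1
      obtain u where u: "u \<in> U" "monom_val u a = poly_val U a"
        using poly_val_attained[OF U] .
      have "monom_mult s u \<noteq> monom_mult s' u"
        using cancel(1) 1 by blast
      then show ?thesis
        using 1 u val[of s u a] val[of s' u a] unfolding tangible_locus_def by (blast intro: monom_mult_in)
    next
      case 2
      obtain s where s: "s \<in> T" "monom_val s a = poly_val T a"
        using poly_val_attained[OF T] .
      have "monom_mult s u \<noteq> monom_mult s u'"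
        using cancel(2) 2 by blast
      then show ?thesis
        using 2 s val[of s u a] val[of s u' a] unfolding tangible_locus_def by (blast intro: monom_mult_in)
    qed
  qed
qed

lemma tangible_locus_regular: "polynomial T \<Longrightarrow> tangible_locus T \<in> regular_corner_loci"
  unfolding regular_corner_loci_eq by (intro CollectI exI[of _ "{T}"]) simp

lemma regular_corner_loci_Int:
  assumes "A \<in> regular_corner_loci" "B \<in> regular_corner_loci"
  shows "A \<inter> B \<in> regular_corner_loci"
proof -
  obtain \<T> \<U> where "finite \<T>" "\<T> \<noteq> {}" "\<And>T. T \<in> \<T> \<Longrightarrow> polynomial T" "A = \<Inter>(tangible_locus ` \<T>)"
    "finite \<U>" "\<U> \<noteq> {}" "\<And>T. T \<in> \<U> \<Longrightarrow> polynomial T" "B = \<Inter>(tangible_locus ` \<U>)"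
    using assms unfolding regular_corner_loci_eq by blast
  then show ?thesis
    unfolding regular_corner_loci_eq by (intro CollectI exI[of _ "\<T> \<union> \<U>"]) auto
qed

text \<open>The union of two intersections is the intersection of all pairwise unions, and these are
  the loci of the products.\<close>

lemma regular_corner_loci_Un:
  assumes "A \<in> regular_corner_loci" "B \<in> regular_corner_loci"
  shows "A \<union> B \<in> regular_corner_loci"
proof -
  obtain \<T> \<U> where T: "finite \<T>" "\<T> \<noteq> {}" "\<And>T. T \<in> \<T> \<Longrightarrow> polynomial T" "A = \<Inter>(tangible_locus ` \<T>)"
    and U: "finite \<U>" "\<U> \<noteq> {}" "\<And>T. T \<in> \<U> \<Longrightarrow> polynomial T" "B = \<Inter>(tangible_locus ` \<U>)"
    using assms unfolding regular_corner_loci_eq by blast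
  define \<V> where "\<V> = (\<Union>T\<in>\<T>. poly_mult T ` \<U>)"
  have "\<Inter>(tangible_locus ` \<V>) = (\<Inter>T\<in>\<T>. \<Inter>U\<in>\<U>. tangible_locus (poly_mult T U))"
    by (auto simp: \<V>_def)
  also have "\<dots> = (\<Inter>T\<in>\<T>. \<Inter>U\<in>\<U>. tangible_locus T \<union> tangible_locus U)"
    using T(3) U(3) by (simp add: tangible_locus_mult)
  also have "\<dots> = A \<union> B"
    unfolding T(4) U(4) by blast
  finally have "A \<union> B = \<Inter>(tangible_locus ` \<V>)" ..
  moreover have "finite \<V>" "\<V> \<noteq> {}" "\<forall>V\<in>\<V>. polynomial V"
    using T U by (auto simp: \<V>_def intro: polynomial_mult)
  ultimately show ?thesis
    unfolding regular_corner_loci_eq by blast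
qed

lemma regular_corner_loci_UN:
  assumes "finite I" "I \<noteq> {}" "\<And>i. i \<in> I \<Longrightarrow> A i \<in> regular_corner_loci"
  shows "(\<Union>i\<in>I. A i) \<in> regular_corner_loci"
  using assms by (induction I rule: finite_ne_induct) (simp_all add: regular_corner_loci_Un)

lemma regular_corner_loci_INT:
  assumes "finite I" "I \<noteq> {}" "\<And>i. i \<in> I \<Longrightarrow> A i \<in> regular_corner_loci"
  shows "(\<Inter>i\<in>I. A i) \<in> regular_corner_loci"
  using assms by (induction I rule: finite_ne_induct) (simp_all add: regular_corner_loci_Int)

text \<open>The locus of \<open>{h, g}\<close> forces the two terms to agree; on it, the locus of
  \<open>{m, h, g}\<close> adds that \<open>m\<close> does not exceed them. Intersecting over all
  \<open>m\<close> in \<open>D\<close> gives the cell.\<close>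

lemma cell_regular_corner_loci:
  assumes hg: "h \<noteq> g" and D: "polynomial D"
  shows "{a. monom_val h a = monom_val g a \<and> poly_val D a \<le> monom_val h a} \<in> regular_corner_loci"
proof -
  define A where "A m = tangible_locus {h, g} \<inter> tangible_locus {m, h, g}" for m
  have two: "a \<in> tangible_locus {h, g} \<longleftrightarrow> monom_val h a = monom_val g a" for a
    using hg by (auto simp: tangible_locus_def poly_val_def)
  have "a \<in> A m \<longleftrightarrow> monom_val h a = monom_val g a \<and> monom_val m a \<le> monom_val h a" for a m
  proof (cases "monom_val h a = monom_val g a")
    case True
    then have pv: "poly_val {m, h, g} a = max (monom_val m a) (monom_val h a)"
      by (simp add: poly_val_def)
    have "a \<in> tangible_locus {m, h, g} \<longleftrightarrow> monom_val m a \<le> monom_val h a"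
    proof
      assume "a \<in> tangible_locus {m, h, g}"
      \<comment> \<open>Two distinct members of \<open>{m, h, g}\<close> cannot both be
        \<open>m\<close>.\<close>
      then have "\<exists>t\<in>{h, g}. monom_val t a = poly_val {m, h, g} a"
        unfolding tangible_locus_def by blast
      then have "monom_val h a = poly_val {m, h, g} a"
        using True by auto
      then show "monom_val m a \<le> monom_val h a"
        using max.cobounded1[of "monom_val m a" "monom_val h a"] by (simp only: pv)
    next
      assume "monom_val m a \<le> monom_val h a"
      then have e: "monom_val h a = poly_val {m, h, g} a" "monom_val g a = poly_val {m, h, g} a"
        using True by (simp_all add: pv max.absorb2)
      show "a \<in> tangible_locus {m, h, g}"
        unfolding tangible_locus_def mem_Collect_eq
        by (rule bexI[of _ h], rule bexI[of _ g], intro conjI hg e) simp_all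
    qed
    then show ?thesis
      using True two by (simp add: A_def)
  qed (simp add: A_def two)
  then have "{a. monom_val h a = monom_val g a \<and> poly_val D a \<le> monom_val h a} = (\<Inter>m\<in>D. A m)"
    using D unfolding poly_val_le_iff[OF D] by (auto simp: polynomial_def)
  also have "\<dots> \<in> regular_corner_loci"
    using D by (intro regular_corner_loci_INT)
      (auto simp: A_def polynomial_def intro!: regular_corner_loci_Int tangible_locus_regular)
  finally show ?thesis .
qed

text \<open>Regularity enters twice: it lets the cells with \<open>h \<noteq> g\<close> cover the
  whole set \<open>f = 1\<close>, and it provides at least one such pair, so that the union is over
  a nonempty index set.\<close>

lemma one_set_regular:
  assumes "regular f"
  shows "{x. f x = 1} \<in> regular_corner_loci"
proof -
  obtain H G where H: "polynomial H" and G: "polynomial G" and f: "f = poly_val H / poly_val G"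
    and reg: "\<And>x. \<exists>h\<in>H. \<exists>g\<in>G. poly_val H x = monom_val h x \<and> poly_val G x = monom_val g x \<and> h \<noteq> g"
    using assms unfolding regular_def by blast
  define I where "I = {(h, g). h \<in> H \<and> g \<in> G \<and> h \<noteq> g}"
  define A where "A = (\<lambda>(h, g). {a. monom_val h a = monom_val g a \<and> poly_val (H \<union> G) a \<le> monom_val h a})"
  have "I \<subseteq> H \<times> G"
    by (auto simp: I_def)
  then have "finite I"
    by (rule finite_subset) (use H G in \<open>simp add: polynomial_def\<close>)
  moreover have "I \<noteq> {}"
    using reg unfolding I_def by blast
  moreover have "A i \<in> regular_corner_loci" if "i \<in> I" for i
  proof -
    obtain h g where "i = (h, g)" "h \<noteq> g"
      using \<open>i \<in> I\<close> unfolding I_def by auto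
    then show ?thesis
      by (simp add: A_def cell_regular_corner_loci polynomial_Un H G)
  qed
  ultimately have "(\<Union>i\<in>I. A i) \<in> regular_corner_loci"
    by (rule regular_corner_loci_UN)
  also have "(\<Union>i\<in>I. A i) = {x. f x = 1}"
  proof -
    have f1: "f x = 1 \<longleftrightarrow> poly_val H x = poly_val G x" for x
      by (simp add: f divide_fun_def divide_eq_iff_sf)
    have "f x = 1" if "i \<in> I" "x \<in> A i" for i x
    proof -
      obtain h g where i: "i = (h, g)"
        by (rule prod.exhaust)
      have hg: "h \<in> H" "g \<in> G" "monom_val h x = monom_val g x" "poly_val (H \<union> G) x \<le> monom_val h x"
        using \<open>i \<in> I\<close> \<open>x \<in> A i\<close> unfolding i I_def A_def by auto
      have "poly_val H x \<le> monom_val h x" "poly_val G x \<le> monom_val g x"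
        using hg(3,4) by (simp_all add: poly_val_Un[OF H G] add_eq_max)
      then have "poly_val H x = monom_val h x" "poly_val G x = monom_val g x"
        using poly_val_ge[OF H hg(1), of x] poly_val_ge[OF G hg(2), of x] by simp_all
      then show ?thesis
        using hg(3) f1 by simp
    qed
    moreover have "\<exists>i\<in>I. x \<in> A i" if "f x = 1" for x
    proof -
      obtain h g where hg: "h \<in> H" "g \<in> G" "poly_val H x = monom_val h x" "poly_val G x = monom_val g x" "h \<noteq> g"
        using reg by blast
      have "poly_val (H \<union> G) x \<le> monom_val h x"
        using that hg f1 by (simp add: poly_val_Un[OF H G] add_eq_max)
      moreover have "monom_val h x = monom_val g x"
        using that hg f1 by simp
      ultimately have "(h, g) \<in> I" "x \<in> A (h, g)"
        using hg by (simp_all add: I_def A_def)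
      then show ?thesis ..
    qed
    ultimately show ?thesis
      by blast
  qed
  finally show ?thesis .
qed

text \<open>Away from \<open>f = 1\<close> numerator and denominator differ in value, so their
  dominant terms differ in any representation. Where \<open>f = 1\<close>, the two dominant terms of
  \<open>T\<close> provide the choice.\<close>

lemma regular_of_tangible_locus:
  assumes f: "f \<in> rational_functions" and T: "polynomial T" and sub: "{x. f x = 1} \<subseteq> tangible_locus T"
  shows "regular f"
proof -
  obtain H G where H: "polynomial H" and G: "polynomial G" and HG: "\<And>x. f x * poly_val G x = poly_val H x"
    using f unfolding rational_functions_iff by blast
  \<comment> \<open>Expanding the fraction by \<open>T\<close> provides a second pair of dominant terms wherever \<open>f = 1\<close>.\<close>
  define H' G' where "H' = poly_mult H T" and "G' = poly_mult G T"
  have pol: "polynomial H'" "polynomial G'"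
    using H G T by (simp_all add: H'_def G'_def polynomial_mult)
  have val: "f x * poly_val G' x = poly_val H' x" for x
    using H G T by (simp add: H'_def G'_def poly_val_mult flip: HG mult.assoc)
  have "f = poly_val H' / poly_val G'"
  proof
    show "f x = (poly_val H' / poly_val G') x" for x
      using divide_eq_iff_sf[of "poly_val H' x" "poly_val G' x" "f x"] val[of x]
      by (simp add: divide_fun_def)
  qed
  moreover have "\<exists>h\<in>H'. \<exists>g\<in>G'. poly_val H' x = monom_val h x \<and> poly_val G' x = monom_val g x \<and> h \<noteq> g" for x
  proof (cases "f x = 1")
    case False
    obtain h where h: "h \<in> H'" "monom_val h x = poly_val H' x"
      using poly_val_attained[OF pol(1)] .
    obtain g where g: "g \<in> G'" "monom_val g x = poly_val G' x"
      using poly_val_attained[OF pol(2)] .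
    have "h \<noteq> g"
    proof
      assume "h = g"
      then have "f x * poly_val G' x = 1 * poly_val G' x"
        using h g val[of x] by simp
      then show False
        using False unfolding mult_right_cancel_sf by simp
    qed
    then show ?thesis
      using h g by metis
  next
    case True
    then obtain s t where st: "s \<in> T" "t \<in> T" "s \<noteq> t" "monom_val s x = poly_val T x" "monom_val t x = poly_val T x"
      using sub unfolding tangible_locus_def by blast
    obtain h where h: "h \<in> H" "monom_val h x = poly_val H x"
      using poly_val_attained[OF H] .
    obtain g where g: "g \<in> G" "monom_val g x = poly_val G x"
      using poly_val_attained[OF G] .
    \<comment> \<open>If \<open>monom_mult h s\<close> equalled both products, cancelling
      \<open>g\<close> would give \<open>s = t\<close>.\<close>
    have "monom_mult h s \<noteq> monom_mult g s \<or> monom_mult h s \<noteq> monom_mult g t"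
      using st(3) by (auto simp: monom_mult_def fun_eq_iff prod_eq_iff)
    then obtain r where "r \<in> T" "monom_val r x = poly_val T x" "monom_mult h s \<noteq> monom_mult g r"
      using st by blast
    then show ?thesis
      using st h g H G T unfolding H'_def G'_def
      by (intro bexI[of _ "monom_mult h s"] bexI[of _ "monom_mult g r"])
        (simp_all add: poly_val_mult monom_val_mult monom_mult_in)
  qed
  ultimately show ?thesis
    using pol unfolding regular_def by blast
qed

lemma regular_corner_loci_subset: "regular_corner_loci \<subseteq> corner_loci"
  unfolding regular_corner_loci_def corner_loci_def by blast

text \<open>Regularity is defined through a representation as a fraction, but it depends only on the
  set \<open>f = 1\<close>. From right to left, a single polynomial of the family suffices, since
  the intersection lies in its locus.\<close>

lemma regular_iff:
  assumes "f \<in> rational_functions"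
  shows "regular f \<longleftrightarrow> {x. f x = 1} \<in> regular_corner_loci"
proof
  assume "{x. f x = 1} \<in> regular_corner_loci"
  then obtain \<T> where \<T>: "\<T> \<noteq> {}" "\<And>T. T \<in> \<T> \<Longrightarrow> polynomial T" "{x. f x = 1} = \<Inter>(tangible_locus ` \<T>)"
    unfolding regular_corner_loci_eq by blast
  then obtain T where "T \<in> \<T>"
    by blast
  then show "regular f"
    using \<T>(2,3) by (intro regular_of_tangible_locus[OF assms, of T]) auto
qed (rule one_set_regular)

section \<open>The correspondence\<close>

lemma dominated_mono:
  assumes "g \<in> dominated S f"
  shows "dominated S g \<subseteq> dominated S f"
proof
  obtain k where k: "\<And>x. av (g x) \<le> av (f x) ^ k"
    using assms by (auto simp: dominated_def)
  fix h assume "h \<in> dominated S g"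
  then obtain l where h: "h \<in> S" "\<And>x. av (h x) \<le> av (g x) ^ l"
    by (auto simp: dominated_def)
  have "av (h x) \<le> av (f x) ^ (k * l)" for x
    using h(2)[of x] power_mono_sf[OF k[of x], of l] by (simp add: power_mult)
  then show "h \<in> dominated S f"
    using h(1) by (auto simp: dominated_def)
qed

lemma const_kernel_eq: "const_kernel \<alpha> = dominated rational_functions (\<lambda>_. \<alpha>)"
  unfolding const_kernel_def by (rule kernel_hull_eq[OF subsemifield_rational const_rational])

text \<open>Since \<open>1 + 1 = 1\<close>, the combination with both coefficients 1 is the sum.
  Kernels can therefore serve as carriers themselves.\<close>

lemma subsemifield_kernel:
  fixes S :: "('a \<Rightarrow> 'r::bipotent_semifield) set"
  assumes "subsemifield S" "kernel S K"
  shows "subsemifield K"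
proof -
  have "a + b \<in> K" if "a \<in> K" "b \<in> K" for a b
  proof -
    have "1 * a + 1 * b \<in> K"
    proof -
      have "1 + 1 = (1 :: 'a \<Rightarrow> 'r)"
        by (simp add: fun_eq_iff add_eq_max)
      then show ?thesis
        using that assms(2) subsemifieldD(1)[OF assms(1)] unfolding kernel_def by blast
    qed
    then show ?thesis
      by simp
  qed
  then show ?thesis
    using assms unfolding kernel_def subsemifield_def by blast
qed

lemma subsemifield_const_kernel: "subsemifield (const_kernel \<alpha>)"
  unfolding const_kernel_eq
  by (rule subsemifield_kernel[OF subsemifield_rational kernel_dominated[OF subsemifield_rational]])

lemma const_kernel_rational: "const_kernel \<alpha> \<subseteq> rational_functions"
  by (auto simp: const_kernel_eq dominated_def)

text \<open>Intersecting the kernel of \<open>f\<close> with that of the constant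
  \<open>\<alpha>\<close> gives a generator inside \<open>const_kernel\<close>. Its skeleton gains
  only the set where the constant is 1, which is empty.\<close>

lemma one_sets_const_kernel:
  assumes \<alpha>: "\<alpha> \<noteq> 1" and L: "L \<in> one_sets"
  shows "\<exists>f\<in>const_kernel \<alpha>. L = {x. f x = 1}"
proof -
  obtain f where f: "f \<in> rational_functions" "L = {x. f x = 1}"
    using L by (auto simp: one_sets_def)
  obtain h where h: "h \<in> rational_functions" "{x. h x = 1} = {x. f x = 1} \<union> {x. (\<lambda>_. \<alpha>) x = 1}"
    "dominated rational_functions f \<inter> dominated rational_functions (\<lambda>_. \<alpha>) = dominated rational_functions h"
    using dominated_Int[OF subsemifield_rational f(1) const_rational[of \<alpha>]] by blast
  have "h \<in> const_kernel \<alpha>"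
    using h(3) dominated_self[OF h(1)] unfolding const_kernel_eq by blast
  then show ?thesis
    using h(2) f(2) \<alpha> by auto
qed

lemma principal_kernels_const_kernel:
  "principal_kernels (const_kernel \<alpha>) = dominated (const_kernel \<alpha>) ` const_kernel \<alpha>"
  unfolding principal_kernels_def Setcompr_eq_image
  by (rule image_cong) (simp_all add: kernel_hull_eq[OF subsemifield_const_kernel])

text \<open>Membership of \<open>g\<close> in \<open>const_kernel\<close> supplies the bound
  required by \<open>bounded_power_bound\<close>. Applied in both directions, this makes
  \<open>Skel\<close> injective.\<close>

lemma dominated_const_kernel_subset:
  fixes f g :: "'r::tropical_semifield ^ 'n::finite \<Rightarrow> 'r"
  assumes f: "f \<in> const_kernel \<alpha>" and g: "g \<in> const_kernel \<alpha>" and sub: "{x. f x = 1} \<subseteq> {x. g x = 1}"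
    and \<alpha>: "\<alpha> \<noteq> 1"
  shows "dominated (const_kernel \<alpha>) g \<subseteq> dominated (const_kernel \<alpha>) f"
proof -
  obtain k where "\<And>x. av (g x) \<le> av \<alpha> ^ k"
    using g unfolding const_kernel_eq dominated_def by blast
  then have "\<exists>k. \<forall>x. av (g x) \<le> av (f x) ^ k"
    using f g sub \<alpha> const_kernel_rational by (intro bounded_power_bound) auto
  then have "g \<in> dominated (const_kernel \<alpha>) f"
    using g by (simp add: dominated_def)
  then show ?thesis
    by (rule dominated_mono)
qed

lemma Skel_principal_kernels:
  fixes \<alpha> :: "'r::tropical_semifield"
  assumes \<alpha>: "\<alpha> \<noteq> 1"
  shows "bij_betw Skel (principal_kernels (const_kernel \<alpha> :: ('r ^ 'n::finite \<Rightarrow> 'r) set)) corner_loci"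
  unfolding bij_betw_def
proof
  show "inj_on Skel (principal_kernels (const_kernel \<alpha> :: ('r ^ 'n \<Rightarrow> 'r) set))"
  proof (rule inj_onI)
    fix K L :: "('r ^ 'n \<Rightarrow> 'r) set"
    assume "K \<in> principal_kernels (const_kernel \<alpha>)" "L \<in> principal_kernels (const_kernel \<alpha>)"
    then obtain f g where fg: "f \<in> const_kernel \<alpha>" "K = dominated (const_kernel \<alpha>) f"
      "g \<in> const_kernel \<alpha>" "L = dominated (const_kernel \<alpha>) g"
      unfolding principal_kernels_const_kernel by blast
    assume "Skel K = Skel L"
    then have "{x. f x = 1} = {x. g x = 1}"
      using fg by (simp add: Skel_dominated)
    then show "K = L"
      using fg dominated_const_kernel_subset[OF _ _ _ \<alpha>] by (metis order.antisym order.refl)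
  qed
  show "Skel ` principal_kernels (const_kernel \<alpha>) = (corner_loci :: ('r ^ 'n) set set)"
  proof (intro equalityI subsetI)
    fix L :: "('r ^ 'n) set"
    assume "L \<in> Skel ` principal_kernels (const_kernel \<alpha>)"
    then obtain f where "f \<in> const_kernel \<alpha>" "L = {x. f x = 1}"
      by (auto simp: principal_kernels_const_kernel Skel_dominated)
    then show "L \<in> corner_loci"
      using one_set_corner_loci const_kernel_rational by blast
  next
    fix L :: "('r ^ 'n) set"
    assume "L \<in> corner_loci"
    then obtain f where "f \<in> const_kernel \<alpha>" "L = {x. f x = 1}"
      using one_sets_const_kernel[OF \<alpha>] corner_loci_eq_one_sets[OF \<alpha>] by blast
    then show "L \<in> Skel ` principal_kernels (const_kernel \<alpha>)"
      by (auto simp: principal_kernels_const_kernel Skel_dominated intro!: image_eqI)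
  qed
qed

lemma principal_kernels_ops:
  assumes "K \<in> principal_kernels (const_kernel \<alpha>)" "L \<in> principal_kernels (const_kernel \<alpha>)"
  shows "K * L \<in> principal_kernels (const_kernel \<alpha>)" "Skel (K * L) = Skel K \<inter> Skel L"
    and "K \<inter> L \<in> principal_kernels (const_kernel \<alpha>)" "Skel (K \<inter> L) = Skel K \<union> Skel L"
proof -
  obtain f g where fg: "f \<in> const_kernel \<alpha>" "g \<in> const_kernel \<alpha>"
    "K = dominated (const_kernel \<alpha>) f" "L = dominated (const_kernel \<alpha>) g"
    using assms unfolding principal_kernels_const_kernel by blast
  obtain h where h: "h \<in> const_kernel \<alpha>" "K * L = dominated (const_kernel \<alpha>) h"
    "{x. h x = 1} = {x. f x = 1} \<inter> {x. g x = 1}"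
    using dominated_times[OF subsemifield_const_kernel fg(1,2)] unfolding fg(3,4) by blast
  show "K * L \<in> principal_kernels (const_kernel \<alpha>)" "Skel (K * L) = Skel K \<inter> Skel L"
    using h by (simp_all add: principal_kernels_const_kernel fg Skel_dominated)
  obtain h where h: "h \<in> const_kernel \<alpha>" "K \<inter> L = dominated (const_kernel \<alpha>) h"
    "{x. h x = 1} = {x. f x = 1} \<union> {x. g x = 1}"
    using dominated_Int[OF subsemifield_const_kernel fg(1,2)] unfolding fg(3,4) by blast
  show "K \<inter> L \<in> principal_kernels (const_kernel \<alpha>)" "Skel (K \<inter> L) = Skel K \<union> Skel L"
    using h by (simp_all add: principal_kernels_const_kernel fg Skel_dominated)
qed

lemma kernel_times_subset_iff:
  assumes "kernel S K" "kernel S L" "kernel S M"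
  shows "K * L \<subseteq> M \<longleftrightarrow> K \<subseteq> M \<and> L \<subseteq> M"
proof
  have one: "1 \<in> K" "1 \<in> L"
    using assms by (simp_all add: kernel_def)
  assume sub: "K * L \<subseteq> M"
  show "K \<subseteq> M \<and> L \<subseteq> M"
  proof (intro conjI subsetI)
    show "a \<in> M" if "a \<in> K" for a
      using set_times_intro[OF that one(2)] sub by auto
    show "b \<in> M" if "b \<in> L" for b
      using set_times_intro[OF one(1) that] sub by auto
  qed
next
  assume sub: "K \<subseteq> M \<and> L \<subseteq> M"
  show "K * L \<subseteq> M"
  proof
    fix c assume "c \<in> K * L"
    then obtain a b where "c = a * b" "a \<in> K" "b \<in> L"
      by (rule set_times_elim)
    then show "c \<in> M"
      using sub assms(3) unfolding kernel_def by blast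
  qed
qed

text \<open>Stated for a subfamily \<open>P\<close> so that it serves both for all principal kernels
  and for the regular ones. The order laws in \<open>Q\<close> are those of sets; closure under
  unions and intersections is carried over from \<open>P\<close> along \<open>Skel\<close>.\<close>

lemma Skel_dual_lattice_iso:
  assumes P: "P \<subseteq> principal_kernels (const_kernel \<alpha>)" and bij: "bij_betw Skel P Q"
    and closed: "\<And>K L. K \<in> P \<Longrightarrow> L \<in> P \<Longrightarrow> K * L \<in> P \<and> K \<inter> L \<in> P"
  shows "dual_lattice_iso Skel P (*) (\<inter>) Q (\<union>) (\<inter>)"
  unfolding dual_lattice_iso_def
proof (intro conjI ballI)
  have ker: "kernel (const_kernel \<alpha>) K" if "K \<in> P" for K
    using that P kernel_dominated[OF subsemifield_const_kernel] unfolding principal_kernels_const_kernel by blast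
  show "lattice_on P (*) (\<inter>)"
    unfolding lattice_on_def
  proof (intro ballI conjI)
    fix K L assume KL: "K \<in> P" "L \<in> P"
    show "K * L \<in> P" "K \<inter> L \<in> P"
      using closed[OF KL] by blast+
    fix M assume M: "M \<in> P"
    show "K * L \<subseteq> M \<longleftrightarrow> K \<subseteq> M \<and> L \<subseteq> M"
      by (rule kernel_times_subset_iff) (rule ker KL M)+
    show "M \<subseteq> K \<inter> L \<longleftrightarrow> M \<subseteq> K \<and> M \<subseteq> L"
      by (rule Int_subset_iff)
  qed
  show ops: "Skel (K * L) = Skel K \<inter> Skel L" "Skel (K \<inter> L) = Skel K \<union> Skel L"
    if "K \<in> P" "L \<in> P" for K L
    using that P principal_kernels_ops[of K \<alpha> L] by blast+
  have Q: "Q = Skel ` P"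
    using bij by (simp add: bij_betw_def)
  have "A \<union> B \<in> Q \<and> A \<inter> B \<in> Q" if "A \<in> Q" "B \<in> Q" for A B
  proof -
    obtain K L where KL: "K \<in> P" "L \<in> P" "A = Skel K" "B = Skel L"
      using \<open>A \<in> Q\<close> \<open>B \<in> Q\<close> unfolding Q by blast
    then show ?thesis
      unfolding Q KL(3,4) ops[OF KL(1,2), symmetric] using closed by blast
  qed
  then show "lattice_on Q (\<union>) (\<inter>)"
    unfolding lattice_on_def by blast
  show "bij_betw Skel P Q"
    by (rule bij)
qed

theorem corollary0p13p5p3:
  fixes \<alpha> :: "'r::tropical_semifield"
  assumes "\<alpha> \<noteq> 1"
  shows "dual_lattice_iso Skel
           (principal_kernels (const_kernel \<alpha> :: ('r ^ 'n::finite \<Rightarrow> 'r) set)) (*) (\<inter>)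
           corner_loci (\<union>) (\<inter>) \<and>
         dual_lattice_iso Skel
           (regular_principal_kernels (const_kernel \<alpha> :: ('r ^ 'n \<Rightarrow> 'r) set)) (*) (\<inter>)
           regular_corner_loci (\<union>) (\<inter>)"
proof
  let ?B = "const_kernel \<alpha> :: ('r ^ 'n \<Rightarrow> 'r) set"
  note bij = Skel_principal_kernels[OF assms, where 'n = 'n]
  show "dual_lattice_iso Skel (principal_kernels ?B) (*) (\<inter>) corner_loci (\<union>) (\<inter>)"
    by (rule Skel_dual_lattice_iso[OF order_refl bij]) (simp add: principal_kernels_ops)
  \<comment> \<open>Regular kernels are recognised by their skeletons, so the second correspondence
    is a restriction of the first.\<close>
  have reg: "regular_principal_kernels ?B = {K \<in> principal_kernels ?B. Skel K \<in> regular_corner_loci}"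
  proof (intro equalityI subsetI)
    fix K assume "K \<in> regular_principal_kernels ?B"
    then obtain f where f: "f \<in> ?B" "regular f" "K = dominated ?B f"
      unfolding regular_principal_kernels_def by (auto simp: kernel_hull_eq[OF subsemifield_const_kernel])
    then show "K \<in> {K \<in> principal_kernels ?B. Skel K \<in> regular_corner_loci}"
      by (simp add: principal_kernels_const_kernel Skel_dominated one_set_regular)
  next
    fix K assume "K \<in> {K \<in> principal_kernels ?B. Skel K \<in> regular_corner_loci}"
    then obtain f where f: "f \<in> ?B" "K = dominated ?B f" "{x. f x = 1} \<in> regular_corner_loci"
      by (auto simp: principal_kernels_const_kernel Skel_dominated)
    then have "regular f"
      using regular_iff const_kernel_rational by blast
    then show "K \<in> regular_principal_kernels ?B"
      using f kernel_hull_eq[OF subsemifield_const_kernel f(1)] unfolding regular_principal_kernels_def by blast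
  qed
  show "dual_lattice_iso Skel (regular_principal_kernels ?B) (*) (\<inter>) regular_corner_loci (\<union>) (\<inter>)"
  proof (rule Skel_dual_lattice_iso)
    show "regular_principal_kernels ?B \<subseteq> principal_kernels ?B"
      unfolding reg by blast
    show "bij_betw Skel (regular_principal_kernels ?B) regular_corner_loci"
    proof (rule bij_betw_imageI)
      show "inj_on Skel (regular_principal_kernels ?B)"
        using bij_betw_imp_inj_on[OF bij] by (rule inj_on_subset) (auto simp: reg)
      show "Skel ` regular_principal_kernels ?B = regular_corner_loci"
      proof (intro equalityI subsetI)
        show "L \<in> regular_corner_loci" if "L \<in> Skel ` regular_principal_kernels ?B" for L
          using that unfolding reg by auto
      next
        fix L :: "('r ^ 'n) set"
        assume L: "L \<in> regular_corner_loci"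
        then have "L \<in> Skel ` principal_kernels ?B"
          using regular_corner_loci_subset bij_betw_imp_surj_on[OF bij] by blast
        then obtain K where "K \<in> principal_kernels ?B" "L = Skel K"
          by blast
        then show "L \<in> Skel ` regular_principal_kernels ?B"
          using L by (simp add: reg)
      qed
    qed
    show "K * L \<in> regular_principal_kernels ?B \<and> K \<inter> L \<in> regular_principal_kernels ?B"
      if "K \<in> regular_principal_kernels ?B" "L \<in> regular_principal_kernels ?B" for K L
    proof -
      have KL: "K \<in> principal_kernels ?B" "L \<in> principal_kernels ?B"
        "Skel K \<in> regular_corner_loci" "Skel L \<in> regular_corner_loci"
        using that by (simp_all add: reg)
      then show ?thesis
        by (simp add: reg principal_kernels_ops[OF KL(1,2)] regular_corner_loci_Int regular_corner_loci_Un)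
    qed
  qed
qed

end
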